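(* Let $S$ be a positive definite (invertible) $d\times d$ complex matrix and let $\gamma\in\mathbb{R}_{>0}^d$ be a vector with $\gamma_1\ge\dots\ge\gamma_d$. Then, for every invertible $d\times d$ complex matrix $V$ such that $\lambda(V^*V)=\gamma$ we have $$\lambda(S)\circ\gamma^\uparrow\ \prec_{\log}\ \lambda(V^*SV)\ \prec_{\log}\ \lambda(S)\circ\gamma\in(\mathbb{R}_{>0}^d)^\downarrow .$$ Moreover, if $\lambda(V^*SV)=(\lambda(S)\circ\gamma^\uparrow)^\downarrow$, then there exists an orthonormal basis $\{v_i\}_{i=1}^d$ of $\mathbb{C}^d$ such that $$S=\sum_{i=1}^d\lambda_i(S)\,v_i\otimes v_i\quad\text{and}\quad|V^*|=\sum_{i=1}^d\gamma_{d+1-i}^{1/2}\,v_i\otimes v_i .$$ Respectively, if $\lambda(V^*SV)=\lambda(S)\circ\gamma$, then there exists an orthonormal basis $\{v_i\}_{i=1}^d$ of $\mathbb{C}^d$ such that $$S=\sum_{i=1}^d\lambda_i(S)\,v_i\otimes v_i\quad\text{and}\quad|V^*|=\sum_{i=1}^d\gamma_i^{1/2}\,v_i\otimes v_i .$$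
   Context: For a positive semidefinite $d\times d$ matrix $A$, $\lambda(A)=(\lambda_i(A))_{i=1}^d$ is the vector of eigenvalues counted with multiplicity in non-increasing order. For $x\in\mathbb{R}^d$, $x^\downarrow$ (resp. $x^\uparrow$) is its rearrangement in non-increasing (resp. non-decreasing) order; $(\mathbb{R}_{>0}^d)^\downarrow$ is the set of non-increasing vectors with positive entries. $x\circ y=(x_iy_i)_i$ is the entrywise product. $(x\otimes y)(z)=\langle z,y\rangle x$. $|V^*|=(VV^* )^{1/2}$. Log-majorization for $x,y\in\mathbb{R}_{\ge0}^d$: $x\prec_{\log}y$ means $\prod_{i=1}^k x_i^\downarrow\le\prod_{i=1}^k y_i^\downarrow$ for $1\le k\le d-1$ and $\prod_{i=1}^d x_i=\prod_{i=1}^d y_i$. *)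

theory Defs
  imports
    "Jordan_Normal_Form.Schur_Decomposition"
    "Jordan_Normal_Form.VS_Connect"
    "HOL-Computational_Algebra.Fundamental_Theorem_Algebra"
begin

text \<open>
  All indices are shifted by one: the coordinates \<open>1, ..., d\<close> of the text are
  the vector indices \<open>0, ..., d - 1\<close>.
  The inner product \<open>x \<bullet>c y\<close> is linear in the first and conjugate linear in the
  second argument. In the order on complex numbers, \<open>0 \<le> z\<close> and \<open>0 < z\<close> include
  that \<open>z\<close> is real.
\<close>

subsection \<open>Real vectors\<close>

definition rearr_dec :: "real vec \<Rightarrow> real vec" where
  "rearr_dec x = vec_of_list (rev (sort (list_of_vec x)))"

definition rearr_inc :: "real vec \<Rightarrow> real vec" where
  "rearr_inc x = vec_of_list (sort (list_of_vec x))"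

definition pos_dec_vecs :: "nat \<Rightarrow> real vec set" where
  "pos_dec_vecs d = {x \<in> carrier_vec d.
     (\<forall>i<d. 0 < x $ i) \<and> (\<forall>i<d. \<forall>j<d. i \<le> j \<longrightarrow> x $ j \<le> x $ i)}"

definition log_majorized :: "real vec \<Rightarrow> real vec \<Rightarrow> bool" (infix "\<prec>\<^sub>log" 50) where
  "x \<prec>\<^sub>log y \<longleftrightarrow>
     dim_vec x = dim_vec y \<and>
     (\<forall>i<dim_vec x. 0 \<le> x $ i) \<and> (\<forall>i<dim_vec y. 0 \<le> y $ i) \<and>
     (\<forall>k. 1 \<le> k \<and> k \<le> dim_vec x - 1 \<longrightarrow>
        (\<Prod>i<k. rearr_dec x $ i) \<le> (\<Prod>i<k. rearr_dec y $ i)) \<and>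
     (\<Prod>i<dim_vec x. x $ i) = (\<Prod>i<dim_vec y. y $ i)"

subsection \<open>Complex matrices\<close>

definition positive_semidefinite :: "complex mat \<Rightarrow> bool" where
  "positive_semidefinite A \<longleftrightarrow>
     square_mat A \<and> mat_adjoint A = A \<and>
     (\<forall>x \<in> carrier_vec (dim_row A). 0 \<le> (A *\<^sub>v x) \<bullet>c x)"

definition positive_definite :: "complex mat \<Rightarrow> bool" where
  "positive_definite A \<longleftrightarrow>
     square_mat A \<and> mat_adjoint A = A \<and>
     (\<forall>x \<in> carrier_vec (dim_row A). x \<noteq> 0\<^sub>v (dim_row A) \<longrightarrow> 0 < (A *\<^sub>v x) \<bullet>c x)"

text \<open>
  The vector of eigenvalues, with multiplicity, in non-increasing order. It is meant for
  positive semidefinite matrices, where all roots of the characteristic polynomial are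
  real (so that \<open>Re\<close> loses nothing) and the algebraic and geometric multiplicities agree.
\<close>

definition eigvals_dec :: "complex mat \<Rightarrow> real vec" where
  "eigvals_dec A =
     vec_of_list (rev (sorted_list_of_multiset (image_mset Re (proots (char_poly A)))))"

text \<open>The positive semidefinite square root of a positive semidefinite matrix.\<close>

definition mat_sqrt :: "complex mat \<Rightarrow> complex mat" where
  "mat_sqrt A = (THE B. positive_semidefinite B \<and> B * B = A)"

definition mat_abs :: "complex mat \<Rightarrow> complex mat" where
  "mat_abs A = mat_sqrt (mat_adjoint A * A)"

definition rank_one :: "complex vec \<Rightarrow> complex vec \<Rightarrow> complex mat" where
  "rank_one x y = mat (dim_vec x) (dim_vec y) (\<lambda>(i, j). x $ i * cnj (y $ j))"

definition finsum_mat :: "nat \<Rightarrow> ('i \<Rightarrow> complex mat) \<Rightarrow> 'i set \<Rightarrow> complex mat" where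
  "finsum_mat d f I = finsum (module_mat TYPE(complex) d d) f I"

definition orthonormal_basis :: "nat \<Rightarrow> (nat \<Rightarrow> complex vec) \<Rightarrow> bool" where
  "orthonormal_basis d v \<longleftrightarrow>
     vectorspace.basis class_ring (module_vec TYPE(complex) d) (v ` {..<d}) \<and>
     (\<forall>i<d. \<forall>j<d. v i \<bullet>c v j = (if i = j then 1 else 0))"

subsection \<open>Consistency with the usual descriptions\<close>

lemma dim_eigvals_dec:
  assumes "A \<in> carrier_mat d d"
  shows "dim_vec (eigvals_dec A) = d"
proof -
  have "size (proots (char_poly A)) = d"
    using degree_monic_char_poly[OF assms] by (simp add: size_proots_complex)
  then show ?thesis
    by (metis eigvals_dec_def dim_vec_of_list length_rev mset_sorted_list_of_multiset
        size_image_mset size_mset)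
qed

lemma mat_adjoint_index:
  assumes "i < dim_col A" "j < dim_row A"
  shows "mat_adjoint A $$ (i, j) = conjugate (A $$ (j, i))"
  using assms by (simp add: mat_adjoint_def mat_of_rows_def)

lemma mat_adjoint_mat_adjoint: "mat_adjoint (mat_adjoint A) = (A :: complex mat)"
  by (rule eq_matI) (auto simp: mat_adjoint_def mat_of_rows_def)

lemma mat_abs_mat_adjoint: "mat_abs (mat_adjoint V) = mat_sqrt (V * mat_adjoint V)"
  by (simp add: mat_abs_def mat_adjoint_mat_adjoint)

lemma rank_one_mult_vec:
  assumes "z \<in> carrier_vec (dim_vec y)"
  shows "rank_one x y *\<^sub>v z = (z \<bullet>c y) \<cdot>\<^sub>v x"
  using assms
  by (intro eq_vecI)
    (auto simp: rank_one_def scalar_prod_def sum_distrib_left sum_distrib_right mult_ac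
      intro!: sum.cong)

lemma finsum_mat_index:
  assumes "finite I" "\<And>k. k \<in> I \<Longrightarrow> f k \<in> carrier_mat d d"
  shows "finsum_mat d f I \<in> carrier_mat d d \<and>
    (\<forall>i<d. \<forall>j<d. finsum_mat d f I $$ (i, j) = (\<Sum>k\<in>I. f k $$ (i, j)))"
  using assms
proof (induction I rule: finite_induct)
  let ?M = "module_mat TYPE(complex) d d"
  have ab: "abelian_monoid ?M"
    by (rule abelian_monoidI) (auto simp: module_mat_def comm_add_mat assoc_add_mat[of _ d d])
  {
    case empty
    show ?case
      by (simp add: finsum_mat_def abelian_monoid.finsum_empty[OF ab]) (simp add: module_mat_def)
  next
    case (insert k I)
    have "finsum_mat d f (insert k I) = f k + finsum_mat d f I"
      using insert abelian_monoid.finsum_insert[OF ab, of I k f]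
      by (auto simp: finsum_mat_def module_mat_def)
    moreover have "f k \<in> carrier_mat d d" using insert by auto
    ultimately show ?case using insert by auto
  }
qed

end

theory Submission
  imports Defs
begin

text \<open>
  Write \<open>\<lambda>\<^sub>i\<close> for eigenvalues in non-increasing order. Both log-majorizations follow from one
  inequality, the multiplicative Lidskii inequality (\<open>multiplicative_lidskii\<close>): for a positive
  definite \<open>K\<close>, an invertible \<open>R\<close> and an index set \<open>J\<close> of size \<open>k\<close>, the product of the
  \<open>\<lambda>\<^sub>j(R\<^sup>* K R)\<close> over \<open>J\<close> is at most the product of the \<open>\<lambda>\<^sub>j(R\<^sup>* R)\<close> over \<open>J\<close> times the product of the
  \<open>k\<close> largest eigenvalues of \<open>K\<close>. With \<open>K = S\<close> and \<open>R = V\<close> this bounds \<open>\<lambda>(V\<^sup>* S V)\<close> from above.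
  With \<open>K = V\<^sup>* S V\<close> and \<open>R = V\<^sup>-\<^sup>1\<close> it bounds products of eigenvalues of \<open>S\<close>; as the eigenvalues of
  \<open>(V V\<^sup>*)\<^sup>-\<^sup>1\<close> are the reciprocals of \<open>\<gamma>\<close> in reverse order, moving them to the other side gives the
  lower bound. The products over all indices agree by multiplicativity of determinants.

  The equality cases are consequences of a rigidity statement (\<open>product_spectrum_rigidity\<close>):
  if the ordered eigenvalues of a product \<open>Y X\<close> are \<open>y\<^sub>i z\<^sub>i\<close>, with \<open>y\<close> the ordered eigenvalues
  of \<open>Y\<close> and \<open>z\<close> the eigenvalues of \<open>X\<close> in some order, then \<open>Y\<close> and \<open>X\<close> have a common
  orthonormal eigenbasis with exactly this pairing. It is proved by induction on the dimension, splitting off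
  a common eigenvector that belongs to the largest eigenvalue of \<open>X\<close>. For the upper bound,
  \<open>Y = S\<close> and \<open>X = V V\<^sup>*\<close>. For the lower bound, \<open>Y = (V\<^sup>* V)\<^sup>-\<^sup>1\<close> and \<open>X = V\<^sup>* S V\<close>,
  where the order of \<open>z\<close> is in general not monotone; \<open>V\<close> then carries the common eigenbasis to one of
  \<open>S\<close> and \<open>V V\<^sup>*\<close> (\<open>eigenbasis_transport\<close>).

  Both arguments use a single comparison principle (\<open>rayleigh_compare\<close>), the
  dimension count behind the min-max theorem: the span of the first \<open>j\<close> eigenvectors of \<open>A\<close>
  meets that of the eigenvectors of \<open>B\<close> from the \<open>j\<close>-th on, and a common vector compares \<open>\<lambda>\<^sub>j(A)\<close>
  with \<open>\<lambda>\<^sub>j(B)\<close>.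
\<close>

section \<open>Adjoints and quadratic forms\<close>

lemma mat_adjoint_carrier [simp]:
  assumes "A \<in> carrier_mat m n"
  shows "mat_adjoint A \<in> carrier_mat n m"
  using assms by (simp add: mat_adjoint_def mat_of_rows_def)

lemma dim_mat_adjoint [simp]:
  "dim_row (mat_adjoint A) = dim_col A" "dim_col (mat_adjoint A) = dim_row A"
  by (simp_all add: mat_adjoint_def)

lemma mat_adjoint_mult:
  fixes A B :: "complex mat"
  assumes "A \<in> carrier_mat m n" and "B \<in> carrier_mat n k"
  shows "mat_adjoint (A * B) = mat_adjoint B * mat_adjoint A"
  using assms
  by (intro eq_matI) (auto simp: mat_adjoint_index scalar_prod_def mult_ac intro!: sum.cong)

lemma mat_adjoint_one [simp]: "mat_adjoint (1\<^sub>m n :: complex mat) = 1\<^sub>m n"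
  by (intro eq_matI) (auto simp: mat_adjoint_index)

lemma adjoint_sandwich_hermitian:
  fixes A R :: "complex mat"
  assumes "A \<in> carrier_mat n n" and "R \<in> carrier_mat n m" and "mat_adjoint A = A"
  shows "mat_adjoint (mat_adjoint R * A * R) = mat_adjoint R * A * R"
proof -
  have R: "mat_adjoint R \<in> carrier_mat m n" using assms by simp
  have "mat_adjoint (mat_adjoint R * A * R) = mat_adjoint R * mat_adjoint (mat_adjoint R * A)"
    using R assms(1,2) by (intro mat_adjoint_mult[of _ m n _ m]) auto
  also have "mat_adjoint (mat_adjoint R * A) = A * R"
    using R assms by (simp add: mat_adjoint_mult[of _ m n _ n] mat_adjoint_mat_adjoint)
  also have "mat_adjoint R * (A * R) = mat_adjoint R * A * R"
    using R assms by (intro assoc_mult_mat[symmetric]) auto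
  finally show ?thesis .
qed

lemma adjoint_inner:
  fixes A :: "complex mat"
  assumes "A \<in> carrier_mat m n" and "x \<in> carrier_vec n" and "y \<in> carrier_vec m"
  shows "(A *\<^sub>v x) \<bullet>c y = x \<bullet>c (mat_adjoint A *\<^sub>v y)"
proof -
  have "(A *\<^sub>v x) \<bullet>c y = (\<Sum>i<m. \<Sum>j<n. A $$ (i, j) * x $ j * cnj (y $ i))"
    using assms by (auto simp: scalar_prod_def sum_distrib_right atLeast0LessThan intro!: sum.cong)
  also have "\<dots> = (\<Sum>j<n. \<Sum>i<m. A $$ (i, j) * x $ j * cnj (y $ i))"
    by (rule sum.swap)
  also have "\<dots> = x \<bullet>c (mat_adjoint A *\<^sub>v y)"
    using assms
    by (auto simp: scalar_prod_def sum_distrib_left atLeast0LessThan mat_adjoint_index mult_ac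
        intro!: sum.cong)
  finally show ?thesis .
qed

lemma hermitian_inner:
  fixes A :: "complex mat"
  assumes "A \<in> carrier_mat n n" and "mat_adjoint A = A"
    and "x \<in> carrier_vec n" and "y \<in> carrier_vec n"
  shows "(A *\<^sub>v x) \<bullet>c y = x \<bullet>c (A *\<^sub>v y)"
  using adjoint_inner[OF assms(1,3,4)] assms(2) by simp

lemma cinner_commute:
  fixes x y :: "complex vec"
  assumes "x \<in> carrier_vec n" and "y \<in> carrier_vec n"
  shows "y \<bullet>c x = cnj (x \<bullet>c y)"
  using assms by (auto simp: scalar_prod_def mult_ac intro!: sum.cong)

lemma cinner_smult_left:
  fixes x y :: "complex vec"
  assumes "x \<in> carrier_vec n" and "y \<in> carrier_vec n"
  shows "(c \<cdot>\<^sub>v x) \<bullet>c y = c * (x \<bullet>c y)"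
  using assms by (auto simp: scalar_prod_def sum_distrib_left mult_ac intro!: sum.cong)

lemma cinner_smult_right:
  fixes x y :: "complex vec"
  assumes "x \<in> carrier_vec n" and "y \<in> carrier_vec n"
  shows "x \<bullet>c (c \<cdot>\<^sub>v y) = cnj c * (x \<bullet>c y)"
  using assms by (auto simp: scalar_prod_def sum_distrib_left mult_ac intro!: sum.cong)

definition norm_sq :: "complex vec \<Rightarrow> real" where
  "norm_sq x = Re (x \<bullet>c x)"

lemma cinner_self: "x \<bullet>c x = complex_of_real (norm_sq x)"
  by (auto simp: norm_sq_def complex_eq_iff scalar_prod_def)

lemma norm_sq_pos:
  assumes "x \<in> carrier_vec n" and "x \<noteq> 0\<^sub>v n"
  shows "0 < norm_sq x"
  using conjugate_square_greater_0_vec[OF assms(1)] assms(2)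
  by (simp add: cinner_self less_complex_def)

lemma norm_sq_smult:
  assumes "x \<in> carrier_vec n"
  shows "norm_sq (complex_of_real c \<cdot>\<^sub>v x) = c\<^sup>2 * norm_sq x"
proof -
  have "(complex_of_real c \<cdot>\<^sub>v x) \<bullet>c (complex_of_real c \<cdot>\<^sub>v x) = complex_of_real (c\<^sup>2 * norm_sq x)"
    using assms
    by (subst cinner_smult_left[of _ n], simp, simp, subst cinner_smult_right[of _ n])
      (simp_all only: cinner_self complex_cnj_complex_of_real of_real_mult power2_eq_square mult.assoc)
  then show ?thesis unfolding norm_sq_def[of "complex_of_real c \<cdot>\<^sub>v x"] by simp
qed

definition quad_form :: "complex mat \<Rightarrow> complex vec \<Rightarrow> real" where
  "quad_form A x = Re ((A *\<^sub>v x) \<bullet>c x)"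

lemma quad_form_sandwich:
  assumes "A \<in> carrier_mat n n" and "R \<in> carrier_mat n m" and "x \<in> carrier_vec m"
  shows "quad_form (mat_adjoint R * A * R) x = quad_form A (R *\<^sub>v x)"
proof -
  have R: "mat_adjoint R \<in> carrier_mat m n" using assms by simp
  have "(mat_adjoint R * A * R) *\<^sub>v x = mat_adjoint R *\<^sub>v (A *\<^sub>v (R *\<^sub>v x))"
    using assms R
    by (simp add: assoc_mult_mat_vec[of _ m n _ m] assoc_mult_mat_vec[of _ m n _ n]
        mult_carrier_mat[of _ m n _ n] mult_mat_vec_carrier[of _ n m])
  then show ?thesis
    using adjoint_inner[OF R _ assms(3), of "A *\<^sub>v (R *\<^sub>v x)"] assms
    by (simp add: quad_form_def mat_adjoint_mat_adjoint)
qed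

lemma quad_form_gram:
  assumes "R \<in> carrier_mat n m" and "x \<in> carrier_vec m"
  shows "quad_form (mat_adjoint R * R) x = norm_sq (R *\<^sub>v x)"
  using quad_form_sandwich[OF one_carrier_mat assms] assms
  by (simp add: quad_form_def norm_sq_def)

section \<open>Orthonormal families and eigenbases\<close>

definition onb :: "nat \<Rightarrow> (nat \<Rightarrow> complex vec) \<Rightarrow> bool" where
  "onb n v \<longleftrightarrow> (\<forall>i<n. v i \<in> carrier_vec n) \<and>
     (\<forall>i<n. \<forall>j<n. v i \<bullet>c v j = (if i = j then 1 else 0))"

definition cols_mat :: "nat \<Rightarrow> (nat \<Rightarrow> complex vec) \<Rightarrow> complex mat" where
  "cols_mat n v = mat n n (\<lambda>(i, j). v j $ i)"

lemma cols_mat_carrier [simp]: "cols_mat n v \<in> carrier_mat n n"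
  by (simp add: cols_mat_def)

lemma onb_unitary:
  assumes "onb n v"
  shows "mat_adjoint (cols_mat n v) * cols_mat n v = 1\<^sub>m n"
    and "cols_mat n v * mat_adjoint (cols_mat n v) = 1\<^sub>m n"
proof -
  show *: "mat_adjoint (cols_mat n v) * cols_mat n v = 1\<^sub>m n"
  proof (rule eq_matI)
    fix i j assume ij: "i < dim_row (1\<^sub>m n :: complex mat)" "j < dim_col (1\<^sub>m n :: complex mat)"
    then have v: "dim_vec (v i) = n" "dim_vec (v j) = n" using assms by (auto simp: onb_def)
    have "(mat_adjoint (cols_mat n v) * cols_mat n v) $$ (i, j) = v j \<bullet>c v i"
      using ij v
      by (auto simp: cols_mat_def scalar_prod_def mat_adjoint_index mult_ac intro!: sum.cong)
    then show "(mat_adjoint (cols_mat n v) * cols_mat n v) $$ (i, j) = 1\<^sub>m n $$ (i, j)"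
      using ij assms by (auto simp: onb_def)
  qed (auto simp: cols_mat_def)
  show "cols_mat n v * mat_adjoint (cols_mat n v) = 1\<^sub>m n"
    by (rule mat_mult_left_right_inverse[OF _ _ *]) simp_all
qed

lemma unitary_onb:
  assumes "U \<in> carrier_mat n n" and "mat_adjoint U * U = 1\<^sub>m n"
  shows "onb n (col U)"
proof -
  have "col U i \<bullet>c col U j = (mat_adjoint U * U) $$ (j, i)" if "i < n" "j < n" for i j
    using that assms(1)
    by (auto simp: scalar_prod_def mat_adjoint_index mult_ac intro!: sum.cong)
  then show ?thesis using assms by (auto simp: onb_def)
qed

lemma adjoint_cols_mat_mult_vec:
  assumes "onb n v" and "x \<in> carrier_vec n"
  shows "mat_adjoint (cols_mat n v) *\<^sub>v x = vec n (\<lambda>i. x \<bullet>c v i)"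
  using assms
  by (intro eq_vecI)
    (auto simp: onb_def cols_mat_def scalar_prod_def mat_adjoint_index mult_ac intro!: sum.cong)

lemma onb_parseval:
  assumes "onb n v" and "x \<in> carrier_vec n" and "y \<in> carrier_vec n"
  shows "x \<bullet>c y = (\<Sum>i<n. (x \<bullet>c v i) * cnj (y \<bullet>c v i))"
proof -
  let ?P = "cols_mat n v"
  have "x \<bullet>c y = (?P *\<^sub>v (mat_adjoint ?P *\<^sub>v x)) \<bullet>c y"
    using assms onb_unitary(2)[OF assms(1)]
    by (simp add: assoc_mult_mat_vec[of _ n n _ n, symmetric])
  also have "\<dots> = (mat_adjoint ?P *\<^sub>v x) \<bullet>c (mat_adjoint ?P *\<^sub>v y)"
    using assms by (intro adjoint_inner[of _ n n]) (auto intro!: mult_mat_vec_carrier[of _ n n])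
  also have "\<dots> = (\<Sum>i<n. (x \<bullet>c v i) * cnj (y \<bullet>c v i))"
    unfolding adjoint_cols_mat_mult_vec[OF assms(1,2)] adjoint_cols_mat_mult_vec[OF assms(1,3)]
    by (simp add: scalar_prod_def atLeast0LessThan)
  finally show ?thesis .
qed

lemma onb_norm_sq:
  assumes "onb n v" and "x \<in> carrier_vec n"
  shows "norm_sq x = (\<Sum>i<n. (cmod (x \<bullet>c v i))\<^sup>2)"
  unfolding norm_sq_def onb_parseval[OF assms assms(2)]
  by (simp add: complex_mult_cnj cmod_power2)

lemma onb_vec_eqI:
  assumes "onb n v" and "x \<in> carrier_vec n" and "y \<in> carrier_vec n"
    and "\<And>i. i < n \<Longrightarrow> x \<bullet>c v i = y \<bullet>c v i"
  shows "x = y"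
proof -
  let ?P = "cols_mat n v"
  have *: "mat_adjoint ?P *\<^sub>v x = mat_adjoint ?P *\<^sub>v y"
    using assms by (simp add: adjoint_cols_mat_mult_vec) (auto intro!: eq_vecI)
  have "?P *\<^sub>v (mat_adjoint ?P *\<^sub>v z) = z" if "z \<in> carrier_vec n" for z
    using that onb_unitary(2)[OF assms(1)]
    by (simp add: assoc_mult_mat_vec[of _ n n _ n, symmetric])
  then show ?thesis using * assms by metis
qed

text \<open>
  A linear map is determined by its values on a basis. Matrices are compared below by
  their action on an orthonormal basis, so that they need not be multiplied out as
  \<open>P D P\<^sup>*\<close>.
\<close>

lemma onb_mat_eqI:
  assumes "onb n v" and "A \<in> carrier_mat n n" and "B \<in> carrier_mat n n"
    and "\<And>i. i < n \<Longrightarrow> A *\<^sub>v v i = B *\<^sub>v v i"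
  shows "A = B"
proof -
  let ?P = "cols_mat n v"
  have c: "col ?P j = v j" if "j < n" for j
    using that assms(1) by (intro eq_vecI) (auto simp: cols_mat_def onb_def)
  have *: "A * ?P = B * ?P"
  proof (rule mat_col_eqI)
    fix j assume "j < dim_col (B * ?P)"
    then have "j < n" by (simp add: cols_mat_def)
    then show "col (A * ?P) j = col (B * ?P) j"
      using assms c by (simp add: col_mult2[of _ n n _ n])
  qed (use assms in \<open>simp_all add: cols_mat_def\<close>)
  have "C * ?P * mat_adjoint ?P = C" if "C \<in> carrier_mat n n" for C
    using that onb_unitary(2)[OF assms(1)] by (simp add: assoc_mult_mat[of _ n n _ n _ n])
  then show ?thesis using * assms by metis
qed

text \<open>
  The eigenvalues are indexed like the basis vectors, so that the statement also records
  which eigenvalue belongs to which vector. This pairing is what the equality cases are about.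
\<close>

definition eigenbasis :: "nat \<Rightarrow> complex mat \<Rightarrow> (nat \<Rightarrow> real) \<Rightarrow> (nat \<Rightarrow> complex vec) \<Rightarrow> bool" where
  "eigenbasis n A a v \<longleftrightarrow> onb n v \<and> (\<forall>i<n. A *\<^sub>v v i = complex_of_real (a i) \<cdot>\<^sub>v v i)"

lemma eigenbasis_carrier:
  "eigenbasis n A a v \<Longrightarrow> i < n \<Longrightarrow> v i \<in> carrier_vec n"
  by (simp add: eigenbasis_def onb_def)

lemma eigenbasis_coeff:
  assumes "A \<in> carrier_mat n n" and "mat_adjoint A = A" and "eigenbasis n A a v"
    and "x \<in> carrier_vec n" and "i < n"
  shows "(A *\<^sub>v x) \<bullet>c v i = a i * (x \<bullet>c v i)"
proof -
  have "(A *\<^sub>v x) \<bullet>c v i = x \<bullet>c (complex_of_real (a i) \<cdot>\<^sub>v v i)"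
    using hermitian_inner[OF assms(1,2,4) eigenbasis_carrier[OF assms(3,5)]] assms(3,5)
    by (simp add: eigenbasis_def)
  then show ?thesis
    using cinner_smult_right[OF assms(4) eigenbasis_carrier[OF assms(3,5)]] by simp
qed

lemma eigenbasis_quad_form:
  assumes "A \<in> carrier_mat n n" and "mat_adjoint A = A" and "eigenbasis n A a v"
    and "x \<in> carrier_vec n"
  shows "quad_form A x = (\<Sum>i<n. a i * (cmod (x \<bullet>c v i))\<^sup>2)"
proof -
  have v: "onb n v" using assms by (simp add: eigenbasis_def)
  have "(A *\<^sub>v x) \<bullet>c x = (\<Sum>i<n. a i * (x \<bullet>c v i) * cnj (x \<bullet>c v i))"
    using onb_parseval[OF v _ assms(4), of "A *\<^sub>v x"] assms
    by (simp add: eigenbasis_coeff mult_mat_vec_carrier)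
  then show ?thesis
    by (simp add: quad_form_def mult.assoc complex_mult_cnj cmod_power2)
qed

section \<open>Comparing quadratic forms on a common vector\<close>

text \<open>
  The conditions are \<open>n - 1\<close> linear equations in \<open>n\<close> unknowns. (For orthonormal bases they ask \<open>x\<close> to
  lie in the span of \<open>v\<^sub>0, ..., v\<^sub>j\<close> and in that of \<open>w\<^sub>j, ..., w\<^sub>n\<^sub>-\<^sub>1\<close>, whose dimensions add up to \<open>n + 1\<close>.)
  Writing the equations as the rows of a square matrix leaves row \<open>j\<close> free; with
  that row zero, the matrix is singular, and any kernel vector serves.
\<close>

lemma exists_vec_orthogonal_to_both:
  fixes v w :: "nat \<Rightarrow> complex vec"
  assumes "\<And>i. i < n \<Longrightarrow> v i \<in> carrier_vec n" and "\<And>i. i < n \<Longrightarrow> w i \<in> carrier_vec n"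
    and "j < n"
  obtains x where "x \<in> carrier_vec n" and "x \<noteq> 0\<^sub>v n"
    and "\<And>i. j < i \<Longrightarrow> i < n \<Longrightarrow> x \<bullet>c v i = 0" and "\<And>i. i < j \<Longrightarrow> x \<bullet>c w i = 0"
proof -
  define r where "r i = (if i < j then conjugate (w i) else if i = j then 0\<^sub>v n else conjugate (v i))" for i
  \<comment> \<open>the linear system for \<open>x\<close>; its row \<open>j\<close> is zero and makes it singular\<close>
  define M where "M = mat n n (\<lambda>(i, k). r i $ k)"
  have M: "M \<in> carrier_mat n n" by (simp add: M_def)
  have r: "r i \<in> carrier_vec n" if "i < n" for i
    using that assms by (simp add: r_def)
  have Mr: "row M i = r i" if "i < n" for i
    using that r[OF that] by (intro eq_vecI) (auto simp: M_def)
  have "transpose_mat M *\<^sub>v unit_vec n j = 0\<^sub>v n"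
  proof (rule eq_vecI)
    fix k assume "k < dim_vec (0\<^sub>v n :: complex vec)"
    then show "(transpose_mat M *\<^sub>v unit_vec n j) $ k = 0\<^sub>v n $ k"
      using assms(3) M by (simp add: M_def r_def)
  qed (use M in simp)
  moreover have "unit_vec n j \<noteq> (0\<^sub>v n :: complex vec)"
  proof
    assume "unit_vec n j = (0\<^sub>v n :: complex vec)"
    then have "unit_vec n j $ j = (0\<^sub>v n :: complex vec) $ j" by simp
    then show False using assms(3) by simp
  qed
  ultimately have "det (transpose_mat M) = 0"
    using det_0_iff_vec_prod_zero[of "transpose_mat M" n] M by (metis transpose_carrier_mat unit_vec_carrier)
  then have "det M = 0" using det_transpose[OF M] by simp
  then obtain x where x: "x \<in> carrier_vec n" "x \<noteq> 0\<^sub>v n" "M *\<^sub>v x = 0\<^sub>v n"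
    using det_0_iff_vec_prod_zero[OF M] by blast
  have rx: "x \<bullet> r i = 0" if "i < n" for i
  proof -
    have "(M *\<^sub>v x) $ i = 0" using x that by simp
    then show ?thesis
      using that M Mr[OF that] comm_scalar_prod[OF r[OF that] x(1)] by simp
  qed
  show ?thesis
  proof (rule that[OF x(1,2)])
    show "x \<bullet>c v i = 0" if "j < i" "i < n" for i
      using rx[OF that(2)] that by (simp add: r_def)
    show "x \<bullet>c w i = 0" if "i < j" for i
      using rx[of i] that assms(3) by (simp add: r_def)
  qed
qed

text \<open>
  If \<open>x\<close> only has components along eigenvalues on one side of \<open>c\<close>, then all terms of
  \<open>\<langle>Ax, x\<rangle> - c |x|\<^sup>2 = \<Sum> (a\<^sub>i - c) |\<langle>x, v\<^sub>i\<rangle>|\<^sup>2\<close> have the same sign, and the sum vanishes only if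
  \<open>A x = c x\<close>. The factor \<open>s\<close> (\<open>1\<close> or \<open>-1\<close> in the applications) treats both sides at once.
\<close>

lemma quad_form_extremal:
  assumes "A \<in> carrier_mat n n" and "mat_adjoint A = A" and "eigenbasis n A a v"
    and x: "x \<in> carrier_vec n"
    and sign: "\<And>i. i < n \<Longrightarrow> x \<bullet>c v i \<noteq> 0 \<Longrightarrow> 0 \<le> s * (a i - c)"
    and s: "s \<noteq> 0"
  shows "0 \<le> s * (quad_form A x - c * norm_sq x)"
    and "quad_form A x = c * norm_sq x \<Longrightarrow> A *\<^sub>v x = complex_of_real c \<cdot>\<^sub>v x"
proof -
  have v: "onb n v" using assms by (simp add: eigenbasis_def)
  have eq: "s * (quad_form A x - c * norm_sq x) = (\<Sum>i<n. s * (a i - c) * (cmod (x \<bullet>c v i))\<^sup>2)"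
    unfolding eigenbasis_quad_form[OF assms(1-4)] onb_norm_sq[OF v x]
    by (simp add: sum_distrib_left sum_subtractf algebra_simps)
  have nonneg: "0 \<le> s * (a i - c) * (cmod (x \<bullet>c v i))\<^sup>2" if "i < n" for i
    using sign[OF that] by (cases "x \<bullet>c v i = 0") auto
  show "0 \<le> s * (quad_form A x - c * norm_sq x)"
    unfolding eq by (rule sum_nonneg) (use nonneg in auto)
  assume "quad_form A x = c * norm_sq x"
  then have "(\<Sum>i<n. s * (a i - c) * (cmod (x \<bullet>c v i))\<^sup>2) = 0" using eq by simp
  then have 0: "s * (a i - c) * (cmod (x \<bullet>c v i))\<^sup>2 = 0" if "i < n" for i
    using that nonneg by (subst (asm) sum_nonneg_eq_0_iff) auto
  show "A *\<^sub>v x = complex_of_real c \<cdot>\<^sub>v x"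
  proof (rule onb_vec_eqI[OF v])
    fix i assume i: "i < n"
    have vi: "v i \<in> carrier_vec n" by (rule eigenbasis_carrier[OF assms(3) i])
    have "(A *\<^sub>v x) \<bullet>c v i = a i * (x \<bullet>c v i)"
      by (rule eigenbasis_coeff[OF assms(1-4) i])
    also have "\<dots> = c * (x \<bullet>c v i)"
      using 0[OF i] s by auto
    finally show "(A *\<^sub>v x) \<bullet>c v i = (complex_of_real c \<cdot>\<^sub>v x) \<bullet>c v i"
      using x vi by (simp add: cinner_smult_left)
  qed (use assms x in \<open>auto intro!: mult_mat_vec_carrier\<close>)
qed

text \<open>
  The comparison principle on which both the inequalities and the equality cases rest:
  one vector sees \<open>A\<close> at level at least \<open>a\<^sub>j\<close> and \<open>B\<close> at level at most \<open>b\<^sub>j\<close>. The inequalities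
  give the monotonicity of ordered eigenvalues (Weyl); when they are sharp, the same vector
  is an eigenvector of both matrices.
\<close>

lemma rayleigh_compare:
  assumes A: "A \<in> carrier_mat n n" "mat_adjoint A = A" "eigenbasis n A a v"
    and a: "\<forall>i k. i \<le> k \<longrightarrow> k < n \<longrightarrow> a k \<le> a i"
    and B: "B \<in> carrier_mat n n" "mat_adjoint B = B" "eigenbasis n B b w"
    and b: "\<forall>i k. i \<le> k \<longrightarrow> k < n \<longrightarrow> b k \<le> b i"
    and j: "j < n"
  obtains x where "x \<in> carrier_vec n" and "x \<noteq> 0\<^sub>v n"
    and "a j * norm_sq x \<le> quad_form A x" and "quad_form B x \<le> b j * norm_sq x"
    and "quad_form A x = a j * norm_sq x \<Longrightarrow> A *\<^sub>v x = complex_of_real (a j) \<cdot>\<^sub>v x"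
    and "quad_form B x = b j * norm_sq x \<Longrightarrow> B *\<^sub>v x = complex_of_real (b j) \<cdot>\<^sub>v x"
proof -
  obtain x where x: "x \<in> carrier_vec n" "x \<noteq> 0\<^sub>v n"
    and xv: "\<And>i. j < i \<Longrightarrow> i < n \<Longrightarrow> x \<bullet>c v i = 0" and xw: "\<And>i. i < j \<Longrightarrow> x \<bullet>c w i = 0"
    using exists_vec_orthogonal_to_both[of n v w j] eigenbasis_carrier[OF A(3)]
      eigenbasis_carrier[OF B(3)] j by metis
  have sa: "0 \<le> 1 * (a i - a j)" if "i < n" "x \<bullet>c v i \<noteq> 0" for i
    using a xv[of i] that j by (cases "i \<le> j") auto
  have sb: "0 \<le> (-1) * (b i - b j)" if "i < n" "x \<bullet>c w i \<noteq> 0" for i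
    using b xw[of i] that j by (cases "j \<le> i") auto
  show ?thesis
    using that[OF x] quad_form_extremal[OF A x(1) sa] quad_form_extremal[OF B x(1) sb]
    by (simp add: algebra_simps)
qed

section \<open>Spectra and unitary deflation\<close>

text \<open>
  Stated through the characteristic polynomial because it is also used for the product of
  two Hermitian matrices, which is in general not Hermitian.
\<close>

definition spectrum_is :: "complex mat \<Rightarrow> real list \<Rightarrow> bool" where
  "spectrum_is A xs \<longleftrightarrow> char_poly A = (\<Prod>x\<leftarrow>xs. [:- complex_of_real x, 1:])"

lemma spectrum_is_length:
  assumes "A \<in> carrier_mat n n" and "spectrum_is A xs"
  shows "length xs = n"
  using degree_monic_char_poly[OF assms(1)] assms(2)
    degree_linear_factors[of uminus "map complex_of_real xs"]
  by (simp add: spectrum_is_def o_def)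

lemma similar_spectrum_is:
  "similar_mat A B \<Longrightarrow> spectrum_is A xs \<longleftrightarrow> spectrum_is B xs"
  by (simp add: spectrum_is_def char_poly_similar)

lemma similar_mat_mult_commute:
  fixes R R' B :: "complex mat"
  assumes "R \<in> carrier_mat n n" and "R' \<in> carrier_mat n n" and "B \<in> carrier_mat n n"
    and "R * R' = 1\<^sub>m n"
  shows "similar_mat (R * B) (B * R)"
proof (rule similar_matI[of _ _ R R' n])
  show "R' * R = 1\<^sub>m n" by (rule mat_mult_left_right_inverse[OF assms(1,2,4)])
  show "{R * B, B * R, R, R'} \<subseteq> carrier_mat n n" using assms by auto
  have "R * (B * R) * R' = R * (B * (R * R'))"
    using assms by (simp add: assoc_mult_mat[of _ n n _ n _ n] mult_carrier_mat[of _ n n _ n])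
  then show "R * B = R * (B * R) * R'" using assms by simp
qed (rule assms)

text \<open>
  Functional calculus: this constructs square roots, their inverses and the truncated
  matrix in the proof of the multiplicative Lidskii inequality.
\<close>

lemma onb_diagonal:
  fixes f :: "nat \<Rightarrow> real"
  assumes "onb n v"
  obtains A where "A \<in> carrier_mat n n" and "mat_adjoint A = A" and "eigenbasis n A f v"
proof -
  let ?P = "cols_mat n v" and ?D = "mat_diag n (\<lambda>i. complex_of_real (f i))"
  let ?A = "mat_adjoint (mat_adjoint ?P) * ?D * mat_adjoint ?P"
  have D: "mat_adjoint ?D = ?D"
    by (intro eq_matI) (auto simp: mat_diag_def mat_adjoint_index)
  have c: "mat_adjoint ?P \<in> carrier_mat n n" by simp
  have A: "?A \<in> carrier_mat n n"
    using c by (simp add: mat_adjoint_mat_adjoint mult_carrier_mat[of _ n n _ n])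
  show ?thesis
  proof (rule that[OF A])
    show "mat_adjoint ?A = ?A"
      by (rule adjoint_sandwich_hermitian[OF mat_diag_dim c D])
    have "?A *\<^sub>v v i = complex_of_real (f i) \<cdot>\<^sub>v v i" if i: "i < n" for i
    proof -
      have vi: "v i \<in> carrier_vec n" using assms i by (simp add: onb_def)
      have "?A *\<^sub>v v i = ?P *\<^sub>v (?D *\<^sub>v (mat_adjoint ?P *\<^sub>v v i))"
        using vi c by (simp add: mat_adjoint_mat_adjoint assoc_mult_mat_vec[of _ n n _ n]
            mult_carrier_mat[of _ n n _ n] mult_mat_vec_carrier[of _ n n])
      also have "mat_adjoint ?P *\<^sub>v v i = unit_vec n i"
        using assms i vi by (intro eq_vecI) (auto simp: adjoint_cols_mat_mult_vec onb_def)
      also have "?D *\<^sub>v unit_vec n i = complex_of_real (f i) \<cdot>\<^sub>v unit_vec n i"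
        using i by (intro eq_vecI) (auto simp: mat_diag_def)
      also have "?P *\<^sub>v (complex_of_real (f i) \<cdot>\<^sub>v unit_vec n i) = complex_of_real (f i) \<cdot>\<^sub>v v i"
        using i vi by (intro eq_vecI) (auto simp: cols_mat_def)
      finally show ?thesis .
    qed
    then show "eigenbasis n ?A f v" using assms by (simp add: eigenbasis_def)
  qed
qed

lemma eigenbasis_spectrum_is:
  assumes A: "A \<in> carrier_mat n n" and v: "eigenbasis n A a v"
  shows "spectrum_is A (map a [0..<n])"
proof -
  let ?P = "cols_mat n v" and ?D = "mat_diag n (\<lambda>i. complex_of_real (a i))"
  have o: "onb n v" using v by (simp add: eigenbasis_def)
  have c: "mat_adjoint ?P \<in> carrier_mat n n" by simp
  have cv: "col ?P j = v j" if "j < n" for j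
    using that o by (intro eq_vecI) (auto simp: cols_mat_def onb_def)
  have AP: "A * ?P = ?P * ?D"
  proof (rule mat_col_eqI)
    fix j assume "j < dim_col (?P * ?D)"
    then have j: "j < n" by (simp add: mat_diag_def)
    then have vj: "v j \<in> carrier_vec n" using o by (simp add: onb_def)
    have "col (A * ?P) j = A *\<^sub>v v j"
      using A j cv by (simp add: col_mult2[of _ n n _ n])
    also have "\<dots> = complex_of_real (a j) \<cdot>\<^sub>v v j" using v j by (simp add: eigenbasis_def)
    also have "\<dots> = col (?P * ?D) j"
      using j vj by (intro eq_vecI) (auto simp: mat_diag_mult_right[of _ n n] cols_mat_def)
    finally show "col (A * ?P) j = col (?P * ?D) j" .
  qed (use A in \<open>simp_all add: cols_mat_def mat_diag_def\<close>)
  have "similar_mat A ?D"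
  proof (rule similar_matI[of _ _ ?P "mat_adjoint ?P" n])
    have "A * ?P * mat_adjoint ?P = A"
      using A c onb_unitary(2)[OF o] by (simp add: assoc_mult_mat[of _ n n _ n _ n])
    then show "A = ?P * ?D * mat_adjoint ?P" using AP by simp
  qed (use A c onb_unitary[OF o] in auto)
  then have "char_poly A = char_poly ?D" by (rule char_poly_similar)
  also have "\<dots> = (\<Prod>x\<leftarrow>diag_mat ?D. [:- x, 1:])"
    by (rule char_poly_upper_triangular[OF mat_diag_dim]) (auto simp: mat_diag_def)
  also have "diag_mat ?D = map (\<lambda>i. complex_of_real (a i)) [0..<n]"
    by (auto simp: diag_mat_def mat_diag_def)
  finally show ?thesis by (simp add: spectrum_is_def o_def)
qed

text \<open>
  Complete \<open>u\<close> to a basis, apply Gram-Schmidt, and normalize.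
\<close>

lemma unit_vector_extends_to_unitary:
  assumes u: "u \<in> carrier_vec n" and u1: "norm_sq u = 1"
  obtains U where "U \<in> carrier_mat n n" and "mat_adjoint U * U = 1\<^sub>m n" and "col U 0 = u"
proof -
  have u0: "u \<noteq> 0\<^sub>v n" using u1 by (auto simp: norm_sq_def)
  have n: "n > 0"
  proof (rule ccontr)
    assume "\<not> 0 < n"
    then have "u = 0\<^sub>v n" using u by (intro eq_vecI) auto
    then show False using u0 by simp
  qed
  interpret cof_vec_space n "TYPE(complex)" .
  let ?bs = "basis_completion u"
  note bc = basis_completion[OF u u0]
  define ws where "ws = gram_schmidt n ?bs"
  note gs = gram_schmidt_result[OF bc(2,4,5) ws_def]
  have len: "length ws = n" using gs(4) bc(6) by simp
  obtain bs' where bs': "?bs = u # bs'" using bc(6,7) n by (cases ?bs) auto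
  have ws0: "ws ! 0 = u"
    using gram_schmidt_hd[OF u, of bs'] len n hd_conv_nth[of ws]
    unfolding ws_def bs' by (metis length_0_conv less_irrefl)
  have wc: "ws ! i \<in> carrier_vec n" if "i < n" for i
    using gs(3) len that by auto
  have wo: "ws ! i \<bullet>c ws ! j = 0 \<longleftrightarrow> i \<noteq> j" if "i < n" "j < n" for i j
    using corthogonalD[OF gs(2)] len that by auto
  define v where "v i = complex_of_real (1 / sqrt (norm_sq (ws ! i))) \<cdot>\<^sub>v ws ! i" for i
  have vo: "onb n v"
    unfolding onb_def
  proof (intro conjI allI impI)
    fix i j assume ij: "i < n" "j < n"
    let ?c = "\<lambda>i. complex_of_real (1 / sqrt (norm_sq (ws ! i)))"
    have e: "v i \<bullet>c v j = ?c i * ?c j * (ws ! i \<bullet>c ws ! j)"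
      using wc[OF ij(1)] wc[OF ij(2)] unfolding v_def
      by (simp add: cinner_smult_left[of _ n] cinner_smult_right[of _ n])
    have "ws ! i \<noteq> 0\<^sub>v n" using wo[OF ij(1) ij(1)] wc[OF ij(1)] by auto
    then have pos: "0 < norm_sq (ws ! i)" using norm_sq_pos wc ij by blast
    show "v i \<bullet>c v j = (if i = j then 1 else 0)"
    proof (cases "i = j")
      case True
      have "norm_sq (v i) = 1"
        unfolding v_def norm_sq_smult[OF wc[OF ij(1)]]
        using pos by (simp add: power_divide)
      then show ?thesis using True cinner_self[of "v i"] by (simp del: conjugate_square_eq_0_vec)
    next
      case False
      then show ?thesis using e wo[OF ij] by simp
    qed
  qed (simp add: v_def wc)
  show ?thesis
  proof (rule that)
    show "mat_adjoint (cols_mat n v) * cols_mat n v = 1\<^sub>m n" by (rule onb_unitary[OF vo])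
    have "v 0 = u" using u u1 by (simp add: v_def ws0)
    then show "col (cols_mat n v) 0 = u"
      using n u by (intro eq_vecI) (auto simp: cols_mat_def)
  qed simp
qed

definition block :: "nat \<Rightarrow> real \<Rightarrow> complex mat \<Rightarrow> complex mat" where
  "block m e B = four_block_mat (mat 1 1 (\<lambda>_. complex_of_real e)) (0\<^sub>m 1 m) (0\<^sub>m m 1) B"

text \<open>
  A unitary \<open>U\<close> splits off the eigenvalue \<open>e\<close>: the remaining matrix \<open>B\<close> describes \<open>A\<close> on the orthogonal
  complement of the first column of \<open>U\<close>. The relation fixes \<open>U\<close>, so that two matrices with a common
  eigenvector can be deflated simultaneously, together with their product.
\<close>

definition deflates :: "nat \<Rightarrow> complex mat \<Rightarrow> complex mat \<Rightarrow> real \<Rightarrow> complex mat \<Rightarrow> bool" where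
  "deflates m U A e B \<longleftrightarrow> B \<in> carrier_mat m m \<and> A = U * block m e B * mat_adjoint U"

text \<open>
  For unitary \<open>U\<close>, the isometry of \<open>\<complex>\<^sup>m\<close> onto the orthogonal complement of the first column of \<open>U\<close>.
\<close>

definition lift_vec :: "complex mat \<Rightarrow> complex vec \<Rightarrow> complex vec" where
  "lift_vec U x = U *\<^sub>v (0\<^sub>v 1 @\<^sub>v x)"

lemma block_carrier [simp]: "B \<in> carrier_mat m m \<Longrightarrow> block m e B \<in> carrier_mat (Suc m) (Suc m)"
  unfolding block_def
  using four_block_carrier_mat[of "mat 1 1 (\<lambda>_. complex_of_real e)" 1 1 B m m] by simp

lemma pad_carrier:
  "x \<in> carrier_vec m \<Longrightarrow> 0\<^sub>v 1 @\<^sub>v x \<in> carrier_vec (Suc m)"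
  using append_carrier_vec[of "0\<^sub>v 1" 1 x m] by simp

lemma lift_vec_carrier:
  assumes "U \<in> carrier_mat (Suc m) (Suc m)" and "x \<in> carrier_vec m"
  shows "lift_vec U x \<in> carrier_vec (Suc m)"
  unfolding lift_vec_def by (rule mult_mat_vec_carrier[OF assms(1) pad_carrier[OF assms(2)]])

lemma deflates_char_poly:
  assumes "deflates m U A e B" and "U \<in> carrier_mat (Suc m) (Suc m)"
    and "mat_adjoint U * U = 1\<^sub>m (Suc m)"
  shows "char_poly A = [:- complex_of_real e, 1:] * char_poly B"
proof -
  have B: "B \<in> carrier_mat m m" and A: "A = U * block m e B * mat_adjoint U"
    using assms by (auto simp: deflates_def)
  have bc: "block m e B \<in> carrier_mat (Suc m) (Suc m)" using B by simp
  have uc: "mat_adjoint U \<in> carrier_mat (Suc m) (Suc m)" using assms by simp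
  have "similar_mat A (block m e B)"
  proof (rule similar_matI[of _ _ U "mat_adjoint U" "Suc m"])
    show "U * mat_adjoint U = 1\<^sub>m (Suc m)"
      using mat_mult_left_right_inverse[OF uc assms(2,3)] .
    show "{A, block m e B, U, mat_adjoint U} \<subseteq> carrier_mat (Suc m) (Suc m)"
      using A bc uc assms(2) by auto
  qed (use assms A in auto)
  then have "char_poly A = char_poly (block m e B)" by (rule char_poly_similar)
  also have "\<dots> = char_poly (mat 1 1 (\<lambda>_. complex_of_real e)) * char_poly B"
    unfolding block_def by (rule char_poly_four_block_zeros_col) (use B in auto)
  also have "char_poly (mat 1 1 (\<lambda>_. complex_of_real e)) = [:- complex_of_real e, 1:]"
    by (subst char_poly_upper_triangular[of _ 1]) (auto simp: diag_mat_def)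
  finally show ?thesis .
qed

lemma deflates_mult:
  assumes "deflates m U A e A'" and "deflates m U B f B'" and U: "U \<in> carrier_mat (Suc m) (Suc m)"
    and UU: "mat_adjoint U * U = 1\<^sub>m (Suc m)"
  shows "deflates m U (A * B) (e * f) (A' * B')"
proof -
  let ?N = "Suc m"
  have A': "A' \<in> carrier_mat m m" and B': "B' \<in> carrier_mat m m"
    and A: "A = U * block m e A' * mat_adjoint U" and B: "B = U * block m f B' * mat_adjoint U"
    using assms by (auto simp: deflates_def)
  have bA: "block m e A' \<in> carrier_mat ?N ?N" and bB: "block m f B' \<in> carrier_mat ?N ?N"
    using A' B' by simp_all
  have uc: "mat_adjoint U \<in> carrier_mat ?N ?N" using U by simp
  have m1: "(U * block m e A') * mat_adjoint U * (U * block m f B' * mat_adjoint U)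
      = (U * block m e A') * (mat_adjoint U * (U * (block m f B' * mat_adjoint U)))"
    using U uc bA bB
    by (simp add: assoc_mult_mat[of _ ?N ?N _ ?N _ ?N] mult_carrier_mat[of _ ?N ?N _ ?N])
  also have "mat_adjoint U * (U * (block m f B' * mat_adjoint U))
      = (mat_adjoint U * U) * (block m f B' * mat_adjoint U)"
    using U uc bB
    by (simp add: assoc_mult_mat[of _ ?N ?N _ ?N _ ?N] mult_carrier_mat[of _ ?N ?N _ ?N])
  also have "(U * block m e A') * \<dots> = U * (block m e A' * block m f B') * mat_adjoint U"
    using U uc bA bB UU
    by (simp add: assoc_mult_mat[of _ ?N ?N _ ?N _ ?N] mult_carrier_mat[of _ ?N ?N _ ?N])
  also have "block m e A' * block m f B' = block m (e * f) (A' * B')"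
    unfolding block_def
    by (subst mult_four_block_mat[of _ 1 1 _ m _ m _ _ 1 _ m])
      (use A' B' in \<open>auto intro!: cong_four_block_mat eq_matI simp: scalar_prod_def\<close>)
  finally show ?thesis using A B A' B' by (simp add: deflates_def)
qed

lemma deflates_lift_vec:
  assumes "deflates m U A e B" and U: "U \<in> carrier_mat (Suc m) (Suc m)"
    and UU: "mat_adjoint U * U = 1\<^sub>m (Suc m)" and x: "x \<in> carrier_vec m"
  shows "A *\<^sub>v lift_vec U x = lift_vec U (B *\<^sub>v x)"
proof -
  let ?N = "Suc m"
  have B: "B \<in> carrier_mat m m" and A: "A = U * block m e B * mat_adjoint U"
    using assms by (auto simp: deflates_def)
  have bB: "block m e B \<in> carrier_mat ?N ?N" using B by simp
  have uc: "mat_adjoint U \<in> carrier_mat ?N ?N" using U by simp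
  have ox: "0\<^sub>v 1 @\<^sub>v x \<in> carrier_vec ?N" by (rule pad_carrier[OF x])
  have "A *\<^sub>v lift_vec U x = U *\<^sub>v (block m e B *\<^sub>v ((mat_adjoint U * U) *\<^sub>v (0\<^sub>v 1 @\<^sub>v x)))"
    unfolding A lift_vec_def using U uc bB ox
    by (simp add: assoc_mult_mat_vec[of _ ?N ?N _ ?N] mult_carrier_mat[of _ ?N ?N _ ?N]
        mult_mat_vec_carrier[of _ ?N ?N])
  also have "(mat_adjoint U * U) *\<^sub>v (0\<^sub>v 1 @\<^sub>v x) = 0\<^sub>v 1 @\<^sub>v x"
    using UU ox by simp
  also have "block m e B *\<^sub>v (0\<^sub>v 1 @\<^sub>v x) = 0\<^sub>v 1 @\<^sub>v (B *\<^sub>v x)"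
    unfolding block_def
    by (subst four_block_mat_mult_vec[of _ 1 1 _ m _ m])
      (use B x in \<open>auto intro!: arg_cong2[of _ _ _ _ append_vec] eq_vecI simp: scalar_prod_def\<close>)
  finally show ?thesis by (simp add: lift_vec_def)
qed

lemma unitary_inner:
  fixes U :: "complex mat"
  assumes U: "U \<in> carrier_mat n n" and UU: "mat_adjoint U * U = 1\<^sub>m n"
    and "x \<in> carrier_vec n" and "y \<in> carrier_vec n"
  shows "(U *\<^sub>v x) \<bullet>c (U *\<^sub>v y) = x \<bullet>c y"
proof -
  have uc: "mat_adjoint U \<in> carrier_mat n n" using U by simp
  have "mat_adjoint U *\<^sub>v (U *\<^sub>v y) = y"
    using assms uc by (simp add: assoc_mult_mat_vec[of _ n n _ n, symmetric])
  then show ?thesis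
    using adjoint_inner[OF U assms(3), of "U *\<^sub>v y"] assms by (simp add: mult_mat_vec_carrier)
qed

lemma lift_vec_inner:
  assumes "U \<in> carrier_mat (Suc m) (Suc m)" and "mat_adjoint U * U = 1\<^sub>m (Suc m)"
    and "x \<in> carrier_vec m" and "y \<in> carrier_vec m"
  shows "lift_vec U x \<bullet>c lift_vec U y = x \<bullet>c y"
  unfolding lift_vec_def
    unitary_inner[OF assms(1,2) pad_carrier[OF assms(3)] pad_carrier[OF assms(4)]]
  using assms by (simp add: scalar_prod_def sum.atLeast0_lessThan_Suc_shift
      append_vec_def del: sum.op_ivl_Suc)

lemma lift_vec_inner_col:
  assumes "U \<in> carrier_mat (Suc m) (Suc m)" and "mat_adjoint U * U = 1\<^sub>m (Suc m)"
    and "x \<in> carrier_vec m"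
  shows "lift_vec U x \<bullet>c col U 0 = 0" and "col U 0 \<bullet>c lift_vec U x = 0"
proof -
  have c: "col U 0 = U *\<^sub>v unit_vec (Suc m) 0"
    using assms by (intro eq_vecI) auto
  show 0: "lift_vec U x \<bullet>c col U 0 = 0"
    unfolding lift_vec_def c
    by (subst unitary_inner[OF assms(1,2) pad_carrier[OF assms(3)]])
      (use assms in \<open>auto simp: scalar_prod_def sum.atLeast0_lessThan_Suc_shift
        simp del: sum.op_ivl_Suc\<close>)
  have "col U 0 \<in> carrier_vec (Suc m)" by (rule col_carrier_vec) (use assms in auto)
  then show "col U 0 \<bullet>c lift_vec U x = 0"
    using 0 cinner_commute[OF lift_vec_carrier[OF assms(1,3)]] by simp
qed

text \<open>
  Conjugating by \<open>U\<close> turns the first column into \<open>e\<close> times the first unit vector; being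
  Hermitian, the conjugated matrix has the corresponding first row as well.
\<close>

lemma deflates_hermitian:
  assumes A: "A \<in> carrier_mat (Suc m) (Suc m)" and herm: "mat_adjoint A = A"
    and U: "U \<in> carrier_mat (Suc m) (Suc m)" and UU: "mat_adjoint U * U = 1\<^sub>m (Suc m)"
    and ev: "A *\<^sub>v col U 0 = complex_of_real e \<cdot>\<^sub>v col U 0"
  obtains B where "deflates m U A e B" and "B \<in> carrier_mat m m" and "mat_adjoint B = B"
proof -
  let ?N = "Suc m"
  have uc: "mat_adjoint U \<in> carrier_mat ?N ?N" using U by simp
  define C where "C = mat_adjoint U * A * U"
  have C: "C \<in> carrier_mat ?N ?N" using A U uc by (simp add: C_def mult_carrier_mat[of _ ?N ?N _ ?N])
  have CH: "mat_adjoint C = C" unfolding C_def by (rule adjoint_sandwich_hermitian[OF A U herm])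
  have "col C 0 = complex_of_real e \<cdot>\<^sub>v unit_vec ?N 0"
  proof -
    have "col C 0 = (mat_adjoint U * A) *\<^sub>v col U 0"
      using A U uc by (simp add: C_def col_mult2[of _ ?N ?N _ ?N] mult_carrier_mat[of _ ?N ?N _ ?N])
    also have "\<dots> = mat_adjoint U *\<^sub>v (A *\<^sub>v col U 0)"
      using A U uc col_carrier_vec[of 0 ?N U ?N] by (intro assoc_mult_mat_vec) auto
    also have "\<dots> = complex_of_real e \<cdot>\<^sub>v col (mat_adjoint U * U) 0"
      unfolding ev using U uc col_carrier_vec[of 0 ?N U ?N]
      by (simp add: col_mult2[of _ ?N ?N _ ?N] mult_mat_vec[of _ ?N ?N])
    finally show ?thesis using UU by simp
  qed
  then have C0: "C $$ (i, 0) = (if i = 0 then complex_of_real e else 0)" if "i < ?N" for i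
    using that C index_col[of i C 0] by auto
  have sym: "C $$ (i, j) = cnj (C $$ (j, i))" if "i < ?N" "j < ?N" for i j
    using mat_adjoint_index[of i C j] CH C that by simp
  have C0': "C $$ (0, i) = (if i = 0 then complex_of_real e else 0)" if "i < ?N" for i
    using sym[of 0 i] C0[OF that] that by auto
  define B where "B = mat m m (\<lambda>(i, j). C $$ (Suc i, Suc j))"
  have B: "B \<in> carrier_mat m m" by (simp add: B_def)
  have BH: "mat_adjoint B = B"
    by (intro eq_matI) (auto simp: B_def mat_adjoint_index sym[symmetric])
  have "C = block m e B"
    by (rule eq_matI) (use C C0 C0' in \<open>auto simp: block_def B_def\<close>)
  moreover have "A = U * C * mat_adjoint U"
  proof -
    have UU': "U * mat_adjoint U = 1\<^sub>m ?N"
      using mat_mult_left_right_inverse[OF uc U UU] .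
    have "U * C * mat_adjoint U = (U * mat_adjoint U) * A * (U * mat_adjoint U)"
      unfolding C_def using A U uc
      by (simp add: assoc_mult_mat[of _ ?N ?N _ ?N _ ?N] mult_carrier_mat[of _ ?N ?N _ ?N])
    then show ?thesis using A UU' by simp
  qed
  ultimately have "deflates m U A e B" using B by (simp add: deflates_def)
  then show ?thesis using that B BH by blast
qed

text \<open>
  In the induction on the dimension, the eigenvector that is split off belongs at a prescribed
  position \<open>j\<close> of the ordered list of eigenvalues, not necessarily at its front.
\<close>

definition insert_at :: "nat \<Rightarrow> 'a \<Rightarrow> (nat \<Rightarrow> 'a) \<Rightarrow> nat \<Rightarrow> 'a" where
  "insert_at j a f i = (if i < j then f i else if i = j then a else f (i - 1))"

lemma onb_insert:
  assumes U: "U \<in> carrier_mat (Suc m) (Suc m)" and UU: "mat_adjoint U * U = 1\<^sub>m (Suc m)"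
    and v: "onb m v" and j: "j \<le> m"
  shows "onb (Suc m) (insert_at j (col U 0) (\<lambda>i. lift_vec U (v i)))"
proof -
  have vc: "v i \<in> carrier_vec m" if "i < m" for i using v that by (simp add: onb_def)
  have vo: "v i \<bullet>c v k = (if i = k then 1 else 0)" if "i < m" "k < m" for i k
    using v that by (simp add: onb_def)
  have u: "col U 0 \<bullet>c col U 0 = 1"
    using unitary_onb[OF U UU] by (simp add: onb_def del: conjugate_square_eq_0_vec)
  note inner = lift_vec_inner[OF U UU vc vc] lift_vec_inner_col[OF U UU vc]
  show ?thesis
    unfolding onb_def
  proof (intro conjI allI impI)
    fix i k assume ik: "i < Suc m" "k < Suc m"
    consider "i < j" | "i = j" | "j < i" "i - 1 < m" using ik by linarith
    then show "insert_at j (col U 0) (\<lambda>i. lift_vec U (v i)) i \<bullet>c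
        insert_at j (col U 0) (\<lambda>i. lift_vec U (v i)) k = (if i = k then 1 else 0)"
      using ik j
      by cases (auto simp: insert_at_def u inner vo)
  next
    fix i assume "i < Suc m"
    then show "insert_at j (col U 0) (\<lambda>i. lift_vec U (v i)) i \<in> carrier_vec (Suc m)"
      using col_carrier_vec[of 0 "Suc m" U "Suc m"] U j lift_vec_carrier[OF U vc] by (auto simp: insert_at_def)
  qed
qed

lemma eigenbasis_insert:
  assumes U: "U \<in> carrier_mat (Suc m) (Suc m)" and UU: "mat_adjoint U * U = 1\<^sub>m (Suc m)"
    and A: "deflates m U A e B" and ev: "A *\<^sub>v col U 0 = complex_of_real e \<cdot>\<^sub>v col U 0"
    and v: "eigenbasis m B b v" and j: "j \<le> m"
  shows "eigenbasis (Suc m) A (insert_at j e b) (insert_at j (col U 0) (\<lambda>i. lift_vec U (v i)))"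
proof -
  have vo: "onb m v" using v by (simp add: eigenbasis_def)
  have vc: "v i \<in> carrier_vec m" if "i < m" for i using vo that by (simp add: onb_def)
  have l: "A *\<^sub>v lift_vec U (v i) = complex_of_real (b i) \<cdot>\<^sub>v lift_vec U (v i)" if i: "i < m" for i
  proof -
    have "lift_vec U (c \<cdot>\<^sub>v v i) = c \<cdot>\<^sub>v lift_vec U (v i)" for c
    proof -
      have "0\<^sub>v 1 @\<^sub>v (c \<cdot>\<^sub>v v i) = c \<cdot>\<^sub>v (0\<^sub>v 1 @\<^sub>v v i)"
        by (intro eq_vecI) auto
      then show ?thesis
        unfolding lift_vec_def using mult_mat_vec[OF U pad_carrier[OF vc[OF i]]] by simp
    qed
    then show ?thesis
      using deflates_lift_vec[OF A U UU vc[OF i]] v i by (simp add: eigenbasis_def)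
  qed
  show ?thesis
    unfolding eigenbasis_def
    using onb_insert[OF U UU vo j] l ev j by (auto simp: insert_at_def)
qed

lemma normalize_vec:
  assumes x: "x \<in> carrier_vec n" "x \<noteq> 0\<^sub>v n"
  obtains c where "c \<cdot>\<^sub>v x \<in> carrier_vec n" and "norm_sq (c \<cdot>\<^sub>v x) = 1"
    and "\<And>e A. A \<in> carrier_mat n n \<Longrightarrow> A *\<^sub>v x = e \<cdot>\<^sub>v x \<Longrightarrow> A *\<^sub>v (c \<cdot>\<^sub>v x) = e \<cdot>\<^sub>v (c \<cdot>\<^sub>v x)"
proof -
  have pos: "0 < norm_sq x" by (rule norm_sq_pos[OF x])
  let ?c = "complex_of_real (1 / sqrt (norm_sq x))"
  have "norm_sq (?c \<cdot>\<^sub>v x) = 1"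
    unfolding norm_sq_smult[OF x(1)] using pos by (simp add: power_divide)
  then show ?thesis
    using that[of ?c] x(1) by (simp add: mult_mat_vec[of _ n n] smult_smult_assoc mult.commute)
qed

text \<open>
  The eigenvalue that is split off first is arbitrary, so the basis can be made to follow
  any given order of the eigenvalues.
\<close>

theorem hermitian_spectral_theorem:
  assumes "A \<in> carrier_mat n n" and "mat_adjoint A = A" and "spectrum_is A xs"
  obtains v where "eigenbasis n A (\<lambda>i. xs ! i) v"
proof -
  have "\<exists>v. eigenbasis n A (\<lambda>i. xs ! i) v"
    using assms
  proof (induction n arbitrary: A xs)
    case 0
    then show ?case by (auto simp: eigenbasis_def onb_def)
  next
    case (Suc m)
    have len: "length xs = Suc m" by (rule spectrum_is_length) (use Suc.prems in auto)
    then obtain e ys where xs: "xs = e # ys" by (cases xs) auto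
    have "poly (char_poly A) (complex_of_real e) = 0"
      using Suc.prems(3) xs by (simp add: spectrum_is_def)
    then have "eigenvalue A (complex_of_real e)"
      using eigenvalue_root_char_poly[OF Suc.prems(1)] by simp
    then obtain x where "eigenvector A x (complex_of_real e)" by (auto simp: eigenvalue_def)
    then have x: "x \<in> carrier_vec (Suc m)" "x \<noteq> 0\<^sub>v (Suc m)" "A *\<^sub>v x = complex_of_real e \<cdot>\<^sub>v x"
      using Suc.prems(1) by (auto simp: eigenvector_def)
    obtain u where u: "u \<in> carrier_vec (Suc m)" "norm_sq u = 1" "A *\<^sub>v u = complex_of_real e \<cdot>\<^sub>v u"
      using normalize_vec[OF x(1,2)] x(3) Suc.prems(1) by metis
    obtain U where U: "U \<in> carrier_mat (Suc m) (Suc m)" "mat_adjoint U * U = 1\<^sub>m (Suc m)" "col U 0 = u"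
      using unit_vector_extends_to_unitary[OF u(1,2)] by metis
    have ev: "A *\<^sub>v col U 0 = complex_of_real e \<cdot>\<^sub>v col U 0" using u U by simp
    obtain B where B: "deflates m U A e B" "B \<in> carrier_mat m m" "mat_adjoint B = B"
      using deflates_hermitian[OF Suc.prems(1,2) U(1,2) ev] by metis
    have "[:- complex_of_real e, 1:] * char_poly B = [:- complex_of_real e, 1:] * (\<Prod>x\<leftarrow>ys. [:- complex_of_real x, 1:])"
      using deflates_char_poly[OF B(1) U(1,2)] Suc.prems(3) by (simp add: xs spectrum_is_def)
    then have "spectrum_is B ys" unfolding spectrum_is_def by (metis mult_left_cancel pCons_eq_0_iff zero_neq_one)
    then obtain v where "eigenbasis m B (\<lambda>i. ys ! i) v" using Suc.IH[OF B(2,3)] by blast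
    from eigenbasis_insert[OF U(1,2) B(1) ev this, of 0]
    have "eigenbasis (Suc m) A (insert_at 0 e ((!) ys)) (insert_at 0 (col U 0) (\<lambda>i. lift_vec U (v i)))"
      by simp
    moreover have "insert_at 0 e ((!) ys) = (\<lambda>i. xs ! i)"
      by (auto simp: insert_at_def xs nth_Cons split: nat.split)
    ultimately show ?case by auto
  qed
  then show ?thesis using that by blast
qed

section \<open>Rigidity of the eigenvalues of a product\<close>

lemma sorted_wrt_ge_nth:
  "sorted_wrt (\<ge>) xs \<Longrightarrow> i \<le> k \<Longrightarrow> k < length xs \<Longrightarrow> xs ! k \<le> xs ! i" for xs :: "real list"
  using sorted_wrt_nth_less[of "(\<ge>)" xs i k] by (cases "i = k") auto

text \<open>
  Let \<open>R\<close> be the positive square root of \<open>Y\<close>. The Hermitian matrix \<open>R X R\<close> is similar to \<open>Y X\<close>,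
  so its \<open>j\<close>-th eigenvalue is \<open>y\<^sub>j z\<^sub>j\<close>. Comparing \<open>R X R\<close> with \<open>Y\<close> at index \<open>j\<close> gives a vector \<open>x\<close>
  for which, since \<open>X \<le> z\<^sub>j\<close>,
  \<open>y\<^sub>j z\<^sub>j |x|\<^sup>2 \<le> \<langle>R X R x, x\<rangle> \<le> z\<^sub>j |R x|\<^sup>2 = z\<^sub>j \<langle>Y x, x\<rangle> \<le> z\<^sub>j y\<^sub>j |x|\<^sup>2\<close>.
  All inequalities are equalities, so \<open>x\<close> is an eigenvector of \<open>R X R\<close> and of \<open>Y\<close>, and
  \<open>R x\<close> is one of \<open>X\<close> and of \<open>Y\<close>.
\<close>

lemma common_top_eigenvector:
  assumes Y: "Y \<in> carrier_mat n n" "mat_adjoint Y = Y" "spectrum_is Y ys"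
    and X: "X \<in> carrier_mat n n" "mat_adjoint X = X" "spectrum_is X zs"
    and YX: "spectrum_is (Y * X) (map2 (*) ys zs)"
    and ys: "sorted_wrt (\<ge>) ys" "\<forall>y\<in>set ys. 0 < y"
    and as: "sorted_wrt (\<ge>) (map2 (*) ys zs)"
    and j: "j < n" and zpos: "0 < zs ! j" and zmax: "\<forall>z\<in>set zs. z \<le> zs ! j"
  obtains u where "u \<in> carrier_vec n" and "norm_sq u = 1"
    and "Y *\<^sub>v u = complex_of_real (ys ! j) \<cdot>\<^sub>v u" and "X *\<^sub>v u = complex_of_real (zs ! j) \<cdot>\<^sub>v u"
proof -
  have len: "length ys = n" "length zs = n"
    using spectrum_is_length Y X by blast+
  define z where "z = zs ! j"
  obtain v where v: "eigenbasis n Y (\<lambda>i. ys ! i) v"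
    using hermitian_spectral_theorem[OF Y] by metis
  have vo: "onb n v" using v by (simp add: eigenbasis_def)
  have vc: "v i \<in> carrier_vec n" if "i < n" for i using vo that by (simp add: onb_def)
  have ypos: "0 < ys ! i" if "i < n" for i using ys(2) len that by simp
  obtain R where R: "R \<in> carrier_mat n n" "mat_adjoint R = R" "eigenbasis n R (\<lambda>i. sqrt (ys ! i)) v"
    using onb_diagonal[OF vo] by metis
  obtain R' where R': "R' \<in> carrier_mat n n" "eigenbasis n R' (\<lambda>i. 1 / sqrt (ys ! i)) v"
    using onb_diagonal[OF vo] by metis
  have Rv: "R *\<^sub>v (c \<cdot>\<^sub>v v i) = (c * complex_of_real (sqrt (ys ! i))) \<cdot>\<^sub>v v i" if "i < n" for i c
    using R(1,3) vc[OF that] that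
    by (simp add: eigenbasis_def mult_mat_vec[of _ n n] smult_smult_assoc)
  have RR: "R * R = Y"
  proof (rule onb_mat_eqI[OF vo])
    fix i assume i: "i < n"
    have "(R * R) *\<^sub>v v i = R *\<^sub>v (complex_of_real (sqrt (ys ! i)) \<cdot>\<^sub>v v i)"
      using R vc[OF i] i by (simp add: assoc_mult_mat_vec[of _ n n _ n] eigenbasis_def)
    also have "\<dots> = complex_of_real (sqrt (ys ! i) * sqrt (ys ! i)) \<cdot>\<^sub>v v i"
      unfolding Rv[OF i] by (simp only: of_real_mult)
    also have "\<dots> = Y *\<^sub>v v i" using ypos[OF i] v i by (simp add: eigenbasis_def)
    finally show "(R * R) *\<^sub>v v i = Y *\<^sub>v v i" .
  qed (use R Y in auto)
  have RR': "R * R' = 1\<^sub>m n"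
  proof (rule onb_mat_eqI[OF vo])
    fix i assume i: "i < n"
    have "(R * R') *\<^sub>v v i = R *\<^sub>v (complex_of_real (1 / sqrt (ys ! i)) \<cdot>\<^sub>v v i)"
      using R R' vc[OF i] i by (simp add: assoc_mult_mat_vec[of _ n n _ n] eigenbasis_def)
    also have "\<dots> = complex_of_real (1 / sqrt (ys ! i) * sqrt (ys ! i)) \<cdot>\<^sub>v v i"
      unfolding Rv[OF i] by simp
    also have "\<dots> = 1\<^sub>m n *\<^sub>v v i" using ypos[OF i] vc[OF i] by simp
    finally show "(R * R') *\<^sub>v v i = 1\<^sub>m n *\<^sub>v v i" .
  qed (use R R' in auto)
  have R'R: "R' * R = 1\<^sub>m n" by (rule mat_mult_left_right_inverse[OF R(1) R'(1) RR'])
  have cancelR: "R' *\<^sub>v (R *\<^sub>v p) = p" if "p \<in> carrier_vec n" for p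
    using that R(1) R'(1) R'R by (simp add: assoc_mult_mat_vec[of _ n n _ n, symmetric])
  have inj: "p = q" if "R *\<^sub>v p = R *\<^sub>v q" "p \<in> carrier_vec n" "q \<in> carrier_vec n" for p q
    using that cancelR by metis
  define A where "A = R * X * R"
  have A: "A \<in> carrier_mat n n" using R X by (simp add: A_def mult_carrier_mat[of _ n n _ n])
  have AH: "mat_adjoint A = A"
    using adjoint_sandwich_hermitian[OF X(1) R(1) X(2)] R(2) by (simp add: A_def)
  have "similar_mat (R * (R * X)) (R * X * R)"
    by (rule similar_mat_mult_commute[OF R(1) R'(1) _ RR']) (use R X in auto)
  moreover have "R * (R * X) = Y * X"
    using R X by (simp add: RR[symmetric] assoc_mult_mat[of _ n n _ n _ n])
  ultimately have "spectrum_is A (map2 (*) ys zs)"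
    using YX similar_spectrum_is unfolding A_def by metis
  then obtain w where w: "eigenbasis n A (\<lambda>i. map2 (*) ys zs ! i) w"
    using hermitian_spectral_theorem[OF A AH] by metis
  have decA: "\<forall>i k. i \<le> k \<longrightarrow> k < n \<longrightarrow> map2 (*) ys zs ! k \<le> map2 (*) ys zs ! i"
    and decY: "\<forall>i k. i \<le> k \<longrightarrow> k < n \<longrightarrow> ys ! k \<le> ys ! i"
    using sorted_wrt_ge_nth[OF as] sorted_wrt_ge_nth[OF ys(1)] len by simp_all
  have aj: "map2 (*) ys zs ! j = ys ! j * z" using len j by (simp add: z_def)
  obtain x where x: "x \<in> carrier_vec n" "x \<noteq> 0\<^sub>v n"
    and 1: "ys ! j * z * norm_sq x \<le> quad_form A x" and 2: "quad_form Y x \<le> ys ! j * norm_sq x"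
    and 3: "quad_form A x = ys ! j * z * norm_sq x \<Longrightarrow> A *\<^sub>v x = complex_of_real (ys ! j * z) \<cdot>\<^sub>v x"
    and 4: "quad_form Y x = ys ! j * norm_sq x \<Longrightarrow> Y *\<^sub>v x = complex_of_real (ys ! j) \<cdot>\<^sub>v x"
    using rayleigh_compare[OF A AH w decA Y(1,2) v decY j] unfolding aj by metis
  have Rx: "R *\<^sub>v x \<in> carrier_vec n" using R x by auto
  have "quad_form A x = quad_form X (R *\<^sub>v x)"
    using quad_form_sandwich[OF X(1) R(1) x(1)] R(2) by (simp add: A_def)
  also have "\<dots> \<le> z * norm_sq (R *\<^sub>v x)"
  proof -
    obtain t where t: "eigenbasis n X (\<lambda>i. zs ! i) t"
      using hermitian_spectral_theorem[OF X] by metis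
    have "0 \<le> (-1) * (quad_form X (R *\<^sub>v x) - z * norm_sq (R *\<^sub>v x))"
      by (rule quad_form_extremal(1)[OF X(1,2) t Rx]) (use zmax len in \<open>auto simp: z_def\<close>)
    then show ?thesis by simp
  qed
  also have "norm_sq (R *\<^sub>v x) = quad_form Y x"
    using quad_form_gram[OF R(1) x(1)] R(2) RR by simp
  finally have 5: "quad_form A x \<le> z * quad_form Y x" .
  have z: "0 < z" using zpos by (simp add: z_def)
  have e: "ys ! j * z * norm_sq x = z * (ys ! j * norm_sq x)" by (simp add: mult_ac)
  have "z * quad_form Y x \<le> z * (ys ! j * norm_sq x)" using 2 z by simp
  then have "quad_form A x = ys ! j * z * norm_sq x" and "z * quad_form Y x = z * (ys ! j * norm_sq x)"
    using 1 5 e by - linarith+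
  then have Ax: "A *\<^sub>v x = complex_of_real (ys ! j * z) \<cdot>\<^sub>v x"
    and Yx: "Y *\<^sub>v x = complex_of_real (ys ! j) \<cdot>\<^sub>v x"
    using 3 4 z by simp_all
  have RRx: "R *\<^sub>v (R *\<^sub>v x) = complex_of_real (ys ! j) \<cdot>\<^sub>v x"
    using Yx R x by (simp add: RR[symmetric] assoc_mult_mat_vec[of _ n n _ n])
  have Yu: "Y *\<^sub>v (R *\<^sub>v x) = complex_of_real (ys ! j) \<cdot>\<^sub>v (R *\<^sub>v x)"
    using R x Rx RRx by (simp add: RR[symmetric] assoc_mult_mat_vec[of _ n n _ n] mult_mat_vec[of _ n n])
  have Xu: "X *\<^sub>v (R *\<^sub>v x) = complex_of_real z \<cdot>\<^sub>v (R *\<^sub>v x)"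
  proof (rule inj)
    have "R *\<^sub>v (X *\<^sub>v (R *\<^sub>v x)) = A *\<^sub>v x"
      using R X x by (simp add: A_def assoc_mult_mat_vec[of _ n n _ n] mult_carrier_mat[of _ n n _ n]
          mult_mat_vec_carrier[of _ n n])
    also have "\<dots> = complex_of_real z \<cdot>\<^sub>v (R *\<^sub>v (R *\<^sub>v x))"
      unfolding Ax RRx by (simp add: smult_smult_assoc mult.commute)
    also have "\<dots> = R *\<^sub>v (complex_of_real z \<cdot>\<^sub>v (R *\<^sub>v x))"
      using R Rx by (simp add: mult_mat_vec[of _ n n])
    finally show "R *\<^sub>v (X *\<^sub>v (R *\<^sub>v x)) = R *\<^sub>v (complex_of_real z \<cdot>\<^sub>v (R *\<^sub>v x))" .
  qed (use X Rx in auto)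
  have "R *\<^sub>v x \<noteq> 0\<^sub>v n"
  proof
    assume "R *\<^sub>v x = 0\<^sub>v n"
    moreover have "R *\<^sub>v 0\<^sub>v n = 0\<^sub>v n" using R(1) by (intro eq_vecI) auto
    ultimately have "x = 0\<^sub>v n" using inj[of x "0\<^sub>v n"] x by simp
    then show False using x by simp
  qed
  then obtain c where "c \<cdot>\<^sub>v (R *\<^sub>v x) \<in> carrier_vec n" "norm_sq (c \<cdot>\<^sub>v (R *\<^sub>v x)) = 1"
    "\<And>e A. A \<in> carrier_mat n n \<Longrightarrow> A *\<^sub>v (R *\<^sub>v x) = e \<cdot>\<^sub>v (R *\<^sub>v x) \<Longrightarrow>
      A *\<^sub>v (c \<cdot>\<^sub>v (R *\<^sub>v x)) = e \<cdot>\<^sub>v (c \<cdot>\<^sub>v (R *\<^sub>v x))"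
    using normalize_vec[OF Rx] by metis
  then show ?thesis using that Yu Xu Y(1) X(1) unfolding z_def by metis
qed

lemma nth_insert_at:
  "(\<lambda>i. (xs @ x # ys) ! i) = insert_at (length xs) x (\<lambda>i. (xs @ ys) ! i)"
  by (rule ext) (auto simp: insert_at_def nth_append nth_Cons')

text \<open>
  If the ordered eigenvalues of \<open>Y X\<close> are the products of the ordered eigenvalues of \<open>Y\<close>
  with those of \<open>X\<close> taken in any order, then \<open>Y\<close> and \<open>X\<close> are diagonal in a common basis, with
  that same pairing. The largest eigenvalue of \<open>X\<close>, wherever it stands in the pairing,
  has a common eigenvector; splitting it off preserves all hypotheses, because deleting
  corresponding entries from ordered lists leaves ordered lists.
\<close>

theorem product_spectrum_rigidity:
  assumes "Y \<in> carrier_mat n n" and "mat_adjoint Y = Y" and "spectrum_is Y ys"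
    and "X \<in> carrier_mat n n" and "mat_adjoint X = X" and "spectrum_is X zs"
    and "spectrum_is (Y * X) (map2 (*) ys zs)"
    and "sorted_wrt (\<ge>) ys" and "\<forall>y\<in>set ys. 0 < y" and "\<forall>z\<in>set zs. 0 < z"
    and "sorted_wrt (\<ge>) (map2 (*) ys zs)"
  obtains v where "eigenbasis n Y (\<lambda>i. ys ! i) v" and "eigenbasis n X (\<lambda>i. zs ! i) v"
proof -
  have "\<exists>v. eigenbasis n Y (\<lambda>i. ys ! i) v \<and> eigenbasis n X (\<lambda>i. zs ! i) v"
    using assms
  proof (induction n arbitrary: Y X ys zs)
    case 0
    then show ?case by (auto simp: eigenbasis_def onb_def)
  next
    case (Suc m)
    note Y = Suc.prems(1-3) and X = Suc.prems(4-6)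
    have len: "length ys = Suc m" "length zs = Suc m"
      using spectrum_is_length Y X by blast+
    obtain j where j: "j < Suc m" "zs ! j = Max (set zs)"
      using Max_in[of "set zs"] len by (metis List.finite_set in_set_conv_nth length_0_conv nat.simps(3) set_empty)
    have zmax: "\<forall>z\<in>set zs. z \<le> zs ! j" using j by simp
    have zpos: "0 < zs ! j" using Suc.prems(10) nth_mem[of j zs] len(2) j(1) by simp
    obtain u where u: "u \<in> carrier_vec (Suc m)" "norm_sq u = 1"
      and Yu: "Y *\<^sub>v u = complex_of_real (ys ! j) \<cdot>\<^sub>v u" and Xu: "X *\<^sub>v u = complex_of_real (zs ! j) \<cdot>\<^sub>v u"
      using common_top_eigenvector[OF Y X Suc.prems(7,8,9,11) j(1) zpos zmax] by metis
    define y z where "y = ys ! j" and "z = zs ! j"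
    define y1 y2 z1 z2 where "y1 = take j ys" and "y2 = drop (Suc j) ys"
      and "z1 = take j zs" and "z2 = drop (Suc j) zs"
    have ysp: "ys = y1 @ y # y2" and zsp: "zs = z1 @ z # z2"
      unfolding y1_def y2_def z1_def z2_def y_def z_def
      using j(1) len by (metis id_take_nth_drop)+
    have l1: "length y1 = j" "length z1 = j" using j len by (simp_all add: y1_def z1_def)
    have mm: "map2 (*) ys zs = map2 (*) y1 z1 @ (y * z) # map2 (*) y2 z2"
      "map2 (*) (y1 @ y2) (z1 @ z2) = map2 (*) y1 z1 @ map2 (*) y2 z2"
      using l1 by (simp_all add: ysp zsp)
    obtain U where U: "U \<in> carrier_mat (Suc m) (Suc m)" "mat_adjoint U * U = 1\<^sub>m (Suc m)" "col U 0 = u"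
      using unit_vector_extends_to_unitary[OF u] by metis
    have evY: "Y *\<^sub>v col U 0 = complex_of_real y \<cdot>\<^sub>v col U 0"
      and evX: "X *\<^sub>v col U 0 = complex_of_real z \<cdot>\<^sub>v col U 0"
      using Yu Xu U by (simp_all add: y_def z_def)
    obtain Y' where Y': "deflates m U Y y Y'" "Y' \<in> carrier_mat m m" "mat_adjoint Y' = Y'"
      using deflates_hermitian[OF Y(1,2) U(1,2) evY] by metis
    obtain X' where X': "deflates m U X z X'" "X' \<in> carrier_mat m m" "mat_adjoint X' = X'"
      using deflates_hermitian[OF X(1,2) U(1,2) evX] by metis
    have red: "spectrum_is B (bs @ cs)"
      if "deflates m U A b B" "spectrum_is A (bs @ b # cs)" for A B b bs cs
    proof -
      have "[:- complex_of_real b, 1:] * char_poly B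
          = [:- complex_of_real b, 1:] * (\<Prod>x\<leftarrow>bs @ cs. [:- complex_of_real x, 1:])"
        using deflates_char_poly[OF that(1) U(1,2)] that(2) by (simp add: spectrum_is_def mult_ac del: mult_pCons_left mult_pCons_right)
      then show ?thesis unfolding spectrum_is_def by (metis mult_left_cancel pCons_eq_0_iff zero_neq_one)
    qed
    have "spectrum_is Y' (y1 @ y2)" using red[OF Y'(1)] Y(3) ysp by simp
    moreover have "spectrum_is X' (z1 @ z2)" using red[OF X'(1)] X(3) zsp by simp
    moreover have "spectrum_is (Y' * X') (map2 (*) (y1 @ y2) (z1 @ z2))"
      unfolding mm(2) using red[OF deflates_mult[OF Y'(1) X'(1) U(1,2)]] Suc.prems(7) mm(1) by simp
    moreover have "sorted_wrt (\<ge>) (y1 @ y2)" using Suc.prems(8) by (simp add: ysp sorted_wrt_append)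
    moreover have "sorted_wrt (\<ge>) (map2 (*) (y1 @ y2) (z1 @ z2))"
      using Suc.prems(11) unfolding mm by (simp add: sorted_wrt_append)
    moreover have "\<forall>y\<in>set (y1 @ y2). 0 < y" "\<forall>z\<in>set (z1 @ z2). 0 < z"
      using Suc.prems(9,10) by (auto simp: ysp zsp)
    ultimately obtain v where v: "eigenbasis m Y' (\<lambda>i. (y1 @ y2) ! i) v" "eigenbasis m X' (\<lambda>i. (z1 @ z2) ! i) v"
      using Suc.IH Y'(2,3) X'(2,3) by metis
    have jm: "j \<le> m" using j by simp
    show ?case
      using eigenbasis_insert[OF U(1,2) Y'(1) evY v(1) jm] eigenbasis_insert[OF U(1,2) X'(1) evX v(2) jm]
      unfolding ysp zsp nth_insert_at l1 by blast
  qed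
  then show ?thesis using that by blast
qed

section \<open>Positive definite matrices and their spectra\<close>

lemma spectrum_is_proots:
  assumes "spectrum_is A xs"
  shows "proots (char_poly A) = image_mset complex_of_real (mset xs)"
proof -
  have "proots (\<Prod>x\<leftarrow>ys. [:- complex_of_real x, 1:]) = image_mset complex_of_real (mset ys)" for ys
  proof (induction ys)
    case (Cons y ys)
    have "(\<Prod>x\<leftarrow>ys. [:- complex_of_real x, 1:]) \<noteq> 0"
      by (auto simp: prod_list_zero_iff)
    then have "proots ([:- complex_of_real y, 1:] * (\<Prod>x\<leftarrow>ys. [:- complex_of_real x, 1:]))
        = {#complex_of_real y#} + image_mset complex_of_real (mset ys)"
      using Cons by (subst proots_mult) simp_all
    then show ?case by simp
  qed simp
  then show ?thesis using assms by (simp add: spectrum_is_def)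
qed

lemma spectrum_is_mset_cong:
  assumes "mset xs = mset ys"
  shows "spectrum_is A xs \<longleftrightarrow> spectrum_is A ys"
proof -
  have "prod_list (map f xs) = prod_list (map f ys)" for f :: "real \<Rightarrow> complex poly"
    by (metis assms mset_map prod_mset_prod_list)
  then show ?thesis by (simp add: spectrum_is_def)
qed

lemma sorted_wrt_ge_iff: "sorted_wrt (\<ge>) (xs :: 'a :: linorder list) \<longleftrightarrow> sorted (rev xs)"
  by (simp add: sorted_wrt_rev)

lemma rev_sort_eqI:
  fixes xs ys :: "real list"
  assumes "mset xs = mset ys" and "sorted_wrt (\<ge>) xs"
  shows "rev (sort ys) = xs"
proof -
  have "sort ys = rev xs"
    by (rule properties_for_sort) (use assms in \<open>simp_all add: sorted_wrt_ge_iff\<close>)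
  then show ?thesis by simp
qed

lemma eigvals_dec_eqI:
  assumes "spectrum_is A xs" and "sorted_wrt (\<ge>) xs"
  shows "eigvals_dec A = vec_of_list xs"
proof -
  have "image_mset Re (proots (char_poly A)) = mset xs"
    using spectrum_is_proots[OF assms(1)] by (simp add: multiset.map_comp o_def)
  then show ?thesis
    using rev_sort_eqI[OF refl assms(2)] by (simp add: eigvals_dec_def sorted_list_of_multiset_mset)
qed

text \<open>
  The characteristic polynomial splits over the complex numbers, and the eigenvalues of a
  Hermitian matrix are real.
\<close>

lemma hermitian_spectrum:
  assumes A: "A \<in> carrier_mat n n" and herm: "mat_adjoint A = A"
  obtains xs where "spectrum_is A xs" and "sorted_wrt (\<ge>) xs"
proof -
  obtain as where as: "char_poly A = (\<Prod>a\<leftarrow>as. [:- a, 1:])"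
    using char_poly_factorized[OF A] by blast
  have real: "complex_of_real (Re a) = a" if "a \<in> set as" for a
  proof -
    have "poly (char_poly A) a = 0"
      unfolding as poly_prod_list using that by (auto simp: prod_list_zero_iff image_iff)
    then have "eigenvalue A a" using eigenvalue_root_char_poly[OF A] by simp
    then obtain x where "eigenvector A x a" by (auto simp: eigenvalue_def)
    then have x: "x \<in> carrier_vec n" "x \<noteq> 0\<^sub>v n" "A *\<^sub>v x = a \<cdot>\<^sub>v x"
      using A by (auto simp: eigenvector_def)
    have "a * (x \<bullet>c x) = cnj a * (x \<bullet>c x)"
      using hermitian_inner[OF A herm x(1) x(1)] x
      by (simp add: cinner_smult_left[of _ n] cinner_smult_right[of _ n] del: conjugate_square_eq_0_vec)
    then have "a = cnj a" using x by simp
    then show ?thesis by (simp add: complex_eq_iff)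
  qed
  have "(\<Prod>a\<leftarrow>as. [:- a, 1:]) = (\<Prod>x\<leftarrow>map Re as. [:- complex_of_real x, 1:])"
    using real by (auto intro!: arg_cong[of _ _ prod_list])
  then have s: "spectrum_is A (map Re as)" using as by (simp add: spectrum_is_def)
  show ?thesis
  proof (rule that)
    show "spectrum_is A (rev (sort (map Re as)))"
      using s spectrum_is_mset_cong[of "map Re as" "rev (sort (map Re as))"] by simp
    show "sorted_wrt (\<ge>) (rev (sort (map Re as)))"
      by (simp add: sorted_wrt_ge_iff)
  qed
qed

lemma spectrum_is_det:
  assumes A: "A \<in> carrier_mat n n" and xs: "spectrum_is A xs"
  shows "det A = complex_of_real (prod_list xs)"
proof -
  have "poly (\<Prod>x\<leftarrow>ys. [:- complex_of_real x, 1:]) 0 = (-1) ^ length ys * complex_of_real (prod_list ys)" for ys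
    by (induction ys) (simp_all)
  then have "poly (char_poly A) 0 = (-1) ^ n * complex_of_real (prod_list xs)"
    using xs spectrum_is_length[OF A xs] by (simp add: spectrum_is_def)
  moreover have "poly (char_poly A) 0 = (-1) ^ n * det A"
  proof -
    have "- char_matrix A 0 = (-1) \<cdot>\<^sub>m A"
      using A by (intro eq_matI) (auto simp: char_matrix_def)
    then show ?thesis using char_poly_matrix[OF A, of 0] A by (simp add: det_smult)
  qed
  ultimately show ?thesis by simp
qed

lemma positive_definiteD:
  assumes "positive_definite A" and "A \<in> carrier_mat n n"
  shows "mat_adjoint A = A"
    and "x \<in> carrier_vec n \<Longrightarrow> x \<noteq> 0\<^sub>v n \<Longrightarrow> 0 < quad_form A x"
  using assms by (auto simp: positive_definite_def quad_form_def less_complex_def)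

lemma positive_definiteI:
  assumes A: "A \<in> carrier_mat n n" and herm: "mat_adjoint A = A"
    and pos: "\<And>x. x \<in> carrier_vec n \<Longrightarrow> x \<noteq> 0\<^sub>v n \<Longrightarrow> 0 < quad_form A x"
  shows "positive_definite A"
proof -
  have "0 < (A *\<^sub>v x) \<bullet>c x" if "x \<in> carrier_vec n" "x \<noteq> 0\<^sub>v n" for x
  proof -
    have Ax: "A *\<^sub>v x \<in> carrier_vec n" using A that by auto
    have "(A *\<^sub>v x) \<bullet>c x = cnj ((A *\<^sub>v x) \<bullet>c x)"
      using hermitian_inner[OF A herm that(1,1)] cinner_commute[OF Ax that(1)] by simp
    then have "Im ((A *\<^sub>v x) \<bullet>c x) = 0" by (simp add: complex_eq_iff)
    then show ?thesis using pos[OF that] by (simp add: quad_form_def less_complex_def)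
  qed
  then show ?thesis using A herm by (auto simp: positive_definite_def)
qed

lemma positive_definite_spectrum_pos:
  assumes "positive_definite A" and A: "A \<in> carrier_mat n n" and "spectrum_is A xs" and "x \<in> set xs"
  shows "0 < x"
proof -
  obtain v where v: "eigenbasis n A (\<lambda>i. xs ! i) v"
    using hermitian_spectral_theorem[OF A positive_definiteD(1)[OF assms(1) A] assms(3)] by metis
  obtain i where i: "i < n" "x = xs ! i"
    using assms(4) spectrum_is_length[OF A assms(3)] by (auto simp: in_set_conv_nth)
  have vi: "v i \<in> carrier_vec n" "v i \<bullet>c v i = 1"
    using v i by (simp_all add: eigenbasis_def onb_def del: conjugate_square_eq_0_vec)
  have "v i \<noteq> 0\<^sub>v n" using vi by auto
  then have "0 < quad_form A (v i)" by (rule positive_definiteD(2)[OF assms(1) A vi(1)])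
  also have "quad_form A (v i) = x"
    using v i vi by (simp add: quad_form_def eigenbasis_def cinner_smult_left[of _ n]
        del: conjugate_square_eq_0_vec)
  finally show ?thesis .
qed

lemma positive_definite_sandwich:
  fixes A R R' :: "complex mat"
  assumes "positive_definite A" and A: "A \<in> carrier_mat n n" and R: "R \<in> carrier_mat n n"
    and R': "R' \<in> carrier_mat n n" and "R' * R = 1\<^sub>m n"
  shows "positive_definite (mat_adjoint R * A * R)"
proof (rule positive_definiteI)
  have c: "mat_adjoint R \<in> carrier_mat n n" using R by simp
  show "mat_adjoint R * A * R \<in> carrier_mat n n"
    using A R c by (simp add: mult_carrier_mat[of _ n n _ n])
  show "mat_adjoint (mat_adjoint R * A * R) = mat_adjoint R * A * R"
    by (rule adjoint_sandwich_hermitian[OF A R positive_definiteD(1)[OF assms(1) A]])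
  fix x :: "complex vec" assume x: "x \<in> carrier_vec n" "x \<noteq> 0\<^sub>v n"
  have "R *\<^sub>v x \<noteq> 0\<^sub>v n"
  proof
    assume "R *\<^sub>v x = 0\<^sub>v n"
    then have "R' *\<^sub>v (R *\<^sub>v x) = 0\<^sub>v n" using R' by (auto intro!: eq_vecI)
    then show False using x R R' assms(5) by (simp add: assoc_mult_mat_vec[of _ n n _ n, symmetric])
  qed
  then show "0 < quad_form (mat_adjoint R * A * R) x"
    unfolding quad_form_sandwich[OF A R x(1)]
    using R x by (intro positive_definiteD(2)[OF assms(1) A]) auto
qed

lemma positive_definite_one: "positive_definite (1\<^sub>m n)"
  by (rule positive_definiteI) (auto simp: quad_form_def norm_sq_pos[unfolded norm_sq_def])

lemma positive_definite_gram:
  assumes R: "R \<in> carrier_mat n n" and R': "R' \<in> carrier_mat n n" and "R' * R = 1\<^sub>m n"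
  shows "positive_definite (mat_adjoint R * R)"
proof -
  have "mat_adjoint R * 1\<^sub>m n = mat_adjoint R" using R by (intro right_mult_one_mat) auto
  then show ?thesis
    using positive_definite_sandwich[OF positive_definite_one one_carrier_mat R R' assms(3)] by simp
qed

section \<open>The multiplicative Lidskii inequality\<close>

text \<open>
  The argument of Li and Mathias. Let \<open>k\<close> be the size of \<open>J\<close> and \<open>t\<close> the \<open>k\<close>-th largest eigenvalue
  of \<open>K\<close>; raise all smaller eigenvalues of \<open>K\<close> to \<open>t\<close>, obtaining \<open>L\<close>. Since \<open>K \<le> L\<close>, the
  ordered eigenvalues \<open>\<nu>\<^sub>j\<close> of \<open>R\<^sup>* L R\<close> dominate the \<open>\<mu>\<^sub>j\<close>; since \<open>t \<le> L\<close>, they dominate \<open>t \<rho>\<^sub>j\<close>. So the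
  product of the quotients \<open>\<nu>\<^sub>j / (t \<rho>\<^sub>j)\<close> over \<open>J\<close> is at most the product over all indices, which
  by determinants is \<open>det L / t\<^sup>n\<close>, that is, \<open>\<kappa>\<^sub>0 \<cdots> \<kappa>\<^sub>k\<^sub>-\<^sub>1 / t\<^sup>k\<close>.
\<close>

theorem multiplicative_lidskii:
  assumes "positive_definite K" and K: "K \<in> carrier_mat n n"
    and R: "R \<in> carrier_mat n n" and R': "R' \<in> carrier_mat n n" "R' * R = 1\<^sub>m n"
    and \<kappa>: "spectrum_is K \<kappa>" "sorted_wrt (\<ge>) \<kappa>"
    and \<rho>: "spectrum_is (mat_adjoint R * R) \<rho>" "sorted_wrt (\<ge>) \<rho>"
    and \<mu>: "spectrum_is (mat_adjoint R * K * R) \<mu>" "sorted_wrt (\<ge>) \<mu>"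
    and J: "J \<subseteq> {..<n}"
  shows "(\<Prod>j\<in>J. \<mu> ! j) \<le> (\<Prod>j\<in>J. \<rho> ! j) * (\<Prod>i<card J. \<kappa> ! i)"
proof (cases "J = {}")
  case False
  define k where "k = card J"
  have finJ: "finite J" using J finite_subset by blast
  have k: "0 < k" "k \<le> n"
    using False finJ card_mono[OF _ J] by (auto simp: k_def card_gt_0_iff)
  have c: "mat_adjoint R \<in> carrier_mat n n" using R by simp
  have KH: "mat_adjoint K = K" by (rule positive_definiteD(1)[OF assms(1) K])
  have len\<kappa>: "length \<kappa> = n" by (rule spectrum_is_length[OF K \<kappa>(1)])
  obtain v where v: "eigenbasis n K (\<lambda>i. \<kappa> ! i) v"
    using hermitian_spectral_theorem[OF K KH \<kappa>(1)] by metis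
  have vo: "onb n v" using v by (simp add: eigenbasis_def)
  define t where "t = \<kappa> ! (k - 1)"
  have t: "0 < t"
    unfolding t_def using positive_definite_spectrum_pos[OF assms(1) K \<kappa>(1)] k len\<kappa> by simp
  obtain L where L: "L \<in> carrier_mat n n" "mat_adjoint L = L" "eigenbasis n L (\<lambda>i. max (\<kappa> ! i) t) v"
    using onb_diagonal[OF vo] by metis
  define G where "G = mat_adjoint R * R"
  define M where "M = mat_adjoint R * K * R"
  define N where "N = mat_adjoint R * L * R"
  have carr: "G \<in> carrier_mat n n" "M \<in> carrier_mat n n" "N \<in> carrier_mat n n"
    using R c K L by (simp_all add: G_def M_def N_def mult_carrier_mat[of _ n n _ n])
  have pdG: "positive_definite G" unfolding G_def by (rule positive_definite_gram[OF R R'])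
  have pdM: "positive_definite M" unfolding M_def by (rule positive_definite_sandwich[OF assms(1) K R R'])
  have NH: "mat_adjoint N = N" unfolding N_def by (rule adjoint_sandwich_hermitian[OF L(1) R L(2)])
  obtain \<nu> where \<nu>: "spectrum_is N \<nu>" "sorted_wrt (\<ge>) \<nu>"
    using hermitian_spectrum[OF carr(3) NH] by metis
  have len: "length \<rho> = n" "length \<mu> = n" "length \<nu> = n"
    using spectrum_is_length carr \<rho>(1) \<mu>(1) \<nu>(1) unfolding G_def M_def by blast+
  have dec: "\<forall>i k. i \<le> k \<longrightarrow> k < n \<longrightarrow> \<rho> ! k \<le> \<rho> ! i"
    "\<forall>i k. i \<le> k \<longrightarrow> k < n \<longrightarrow> \<mu> ! k \<le> \<mu> ! i" "\<forall>i k. i \<le> k \<longrightarrow> k < n \<longrightarrow> \<nu> ! k \<le> \<nu> ! i"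
    using sorted_wrt_ge_nth[OF \<rho>(2)] sorted_wrt_ge_nth[OF \<mu>(2)] sorted_wrt_ge_nth[OF \<nu>(2)] len
    by simp_all
  obtain g where g: "eigenbasis n G (\<lambda>i. \<rho> ! i) g"
    using hermitian_spectral_theorem[OF carr(1) positive_definiteD(1)[OF pdG carr(1)]] \<rho>(1)
    unfolding G_def by metis
  obtain m where m: "eigenbasis n M (\<lambda>i. \<mu> ! i) m"
    using hermitian_spectral_theorem[OF carr(2) positive_definiteD(1)[OF pdM carr(2)]] \<mu>(1)
    unfolding M_def by metis
  obtain h where h: "eigenbasis n N (\<lambda>i. \<nu> ! i) h"
    using hermitian_spectral_theorem[OF carr(3) NH \<nu>(1)] by metis
  have qK: "quad_form K y \<le> quad_form L y" if "y \<in> carrier_vec n" for y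
    unfolding eigenbasis_quad_form[OF K KH v that] eigenbasis_quad_form[OF L that]
    by (intro sum_mono mult_right_mono) auto
  have qL: "t * norm_sq y \<le> quad_form L y" if "y \<in> carrier_vec n" for y
    using quad_form_extremal(1)[OF L that, of 1 t] by simp
  have mono: "\<mu> ! j \<le> \<nu> ! j" if j: "j < n" for j
  proof -
    obtain x where x: "x \<in> carrier_vec n" "x \<noteq> 0\<^sub>v n"
      and "\<mu> ! j * norm_sq x \<le> quad_form M x" "quad_form N x \<le> \<nu> ! j * norm_sq x"
      using rayleigh_compare[OF carr(2) positive_definiteD(1)[OF pdM carr(2)] m dec(2) carr(3) NH h dec(3) j]
      by metis
    moreover have "quad_form M x \<le> quad_form N x"
      unfolding M_def N_def quad_form_sandwich[OF K R x(1)] quad_form_sandwich[OF L(1) R x(1)]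
      using R x by (intro qK) auto
    ultimately have "\<mu> ! j * norm_sq x \<le> \<nu> ! j * norm_sq x" by simp
    then show ?thesis using norm_sq_pos[OF x] by simp
  qed
  have lower: "t * \<rho> ! j \<le> \<nu> ! j" if j: "j < n" for j
  proof -
    obtain x where x: "x \<in> carrier_vec n" "x \<noteq> 0\<^sub>v n"
      and 1: "\<rho> ! j * norm_sq x \<le> quad_form G x" and 2: "quad_form N x \<le> \<nu> ! j * norm_sq x"
      using rayleigh_compare[OF carr(1) positive_definiteD(1)[OF pdG carr(1)] g dec(1) carr(3) NH h dec(3) j]
      by metis
    have "t * (\<rho> ! j * norm_sq x) \<le> t * quad_form G x" using 1 t by simp
    also have "\<dots> \<le> quad_form N x"
      unfolding G_def N_def quad_form_gram[OF R x(1)] quad_form_sandwich[OF L(1) R x(1)]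
      using R x by (intro qL) auto
    finally have "t * \<rho> ! j * norm_sq x \<le> \<nu> ! j * norm_sq x" using 2 by simp
    then show ?thesis using norm_sq_pos[OF x] by simp
  qed
  have pos: "0 < \<rho> ! j" "0 < \<mu> ! j" if "j < n" for j
    using positive_definite_spectrum_pos[OF pdG carr(1)] positive_definite_spectrum_pos[OF pdM carr(2)]
      \<rho>(1) \<mu>(1) len that unfolding G_def M_def by simp_all
  have all: "(\<Prod>j<n. \<nu> ! j) = (\<Prod>j<n. \<rho> ! j) * (\<Prod>i<n. max (\<kappa> ! i) t)"
  proof -
    have pl: "prod_list xs = (\<Prod>j<n. xs ! j)" if "length xs = n" for xs :: "real list"
      using that by (simp add: prod.list_conv_set_nth atLeast0LessThan)
    have sL: "spectrum_is L (map (\<lambda>i. max (\<kappa> ! i) t) [0..<n])"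
      by (rule eigenbasis_spectrum_is[OF L(1,3)])
    have "det N = det G * det L"
      using R c L by (simp add: N_def G_def det_mult[of _ n] mult_carrier_mat[of _ n n _ n])
    then have "complex_of_real (prod_list \<nu>)
        = complex_of_real (prod_list \<rho> * prod_list (map (\<lambda>i. max (\<kappa> ! i) t) [0..<n]))"
      using spectrum_is_det[OF carr(3) \<nu>(1)] spectrum_is_det[OF carr(1)] \<rho>(1)
        spectrum_is_det[OF L(1) sL] by (simp add: G_def)
    then have "prod_list \<nu> = prod_list \<rho> * prod_list (map (\<lambda>i. max (\<kappa> ! i) t) [0..<n])"
      using of_real_eq_iff by blast
    then show ?thesis using len pl by simp
  qed
  have "(\<Prod>i<n. max (\<kappa> ! i) t) = (\<Prod>i<k. max (\<kappa> ! i) t) * (\<Prod>i\<in>{k..<n}. max (\<kappa> ! i) t)"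
    using k by (subst prod.union_disjoint[symmetric]) (auto intro!: prod.cong)
  also have "(\<Prod>i<k. max (\<kappa> ! i) t) = (\<Prod>i<k. \<kappa> ! i)"
    unfolding t_def using sorted_wrt_ge_nth[OF \<kappa>(2)] k len\<kappa> by (intro prod.cong) (auto simp: max_def antisym)
  also have "(\<Prod>i\<in>{k..<n}. max (\<kappa> ! i) t) = (\<Prod>i\<in>{k..<n}. t)"
    unfolding t_def using sorted_wrt_ge_nth[OF \<kappa>(2)] k len\<kappa> by (intro prod.cong) (auto simp: max_def)
  finally have \<kappa>': "(\<Prod>i<n. max (\<kappa> ! i) t) = (\<Prod>i<k. \<kappa> ! i) * t ^ (n - k)" by simp
  have split: "(\<Prod>j<n. f j) = (\<Prod>j\<in>J. f j) * (\<Prod>j\<in>{..<n} - J. f j)" for f :: "nat \<Rightarrow> real"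
    using prod.subset_diff[OF J, of f] by (simp add: mult.commute)
  have cardc: "card ({..<n} - J) = n - k" using J finJ by (simp add: card_Diff_subset k_def)
  have nonneg: "0 \<le> \<mu> ! j" "0 \<le> \<nu> ! j" "0 \<le> t * \<rho> ! j" if "j < n" for j
    using pos[OF that] mono[OF that] t by auto
  \<comment> \<open>the factor that extends a product over \<open>J\<close> to one over all indices; it is cancelled at the end\<close>
  define q where "q = t ^ (n - k) * (\<Prod>j\<in>{..<n} - J. \<rho> ! j)"
  have q: "0 < q" unfolding q_def using t pos by (intro mult_pos_pos prod_pos zero_less_power) auto
  have "(\<Prod>j\<in>J. \<mu> ! j) * q = (\<Prod>j\<in>J. \<mu> ! j) * (\<Prod>j\<in>{..<n} - J. t * \<rho> ! j)"
    by (simp add: q_def prod.distrib cardc)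
  also have "\<dots> \<le> (\<Prod>j\<in>J. \<nu> ! j) * (\<Prod>j\<in>{..<n} - J. \<nu> ! j)"
  proof (rule mult_mono)
    show "(\<Prod>j\<in>J. \<mu> ! j) \<le> (\<Prod>j\<in>J. \<nu> ! j)"
      using J mono nonneg by (intro prod_mono) auto
    show "(\<Prod>j\<in>{..<n} - J. t * \<rho> ! j) \<le> (\<Prod>j\<in>{..<n} - J. \<nu> ! j)"
      using lower nonneg by (intro prod_mono) auto
    show "0 \<le> (\<Prod>j\<in>J. \<nu> ! j)"
      using J nonneg by (intro prod_nonneg) auto
    show "0 \<le> (\<Prod>j\<in>{..<n} - J. t * \<rho> ! j)"
      using nonneg by (intro prod_nonneg) auto
  qed
  also have "\<dots> = (\<Prod>j\<in>J. \<rho> ! j) * (\<Prod>i<k. \<kappa> ! i) * q"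
    unfolding split[symmetric] all \<kappa>' q_def by (simp add: split[of "\<lambda>j. \<rho> ! j"])
  finally show ?thesis using q by (simp add: k_def)
qed simp

section \<open>Spectral sums, square roots and inverses\<close>

lemma onb_imp_orthonormal_basis:
  assumes v: "onb n v"
  shows "orthonormal_basis n v"
proof -
  interpret vec_space "TYPE(complex)" n .
  have vc: "v i \<in> carrier_vec n" if "i < n" for i using v that by (simp add: onb_def)
  have inj: "inj_on v {..<n}"
  proof (rule inj_onI)
    fix i j assume ij: "i \<in> {..<n}" "j \<in> {..<n}" and e: "v i = v j"
    have "v i \<bullet>c v j = (if i = j then 1 else 0)" "v i \<bullet>c v i = 1"
      using v ij by (simp_all add: onb_def del: conjugate_square_eq_0_vec)
    then show "i = j" using e by (metis zero_neq_one)
  qed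
  have c: "col (cols_mat n v) j = v j" if "j < n" for j
    using vc[OF that] that by (intro eq_vecI) (auto simp: cols_mat_def)
  have cs: "set (cols (cols_mat n v)) = v ` {..<n}"
    using c by (auto simp: cols_def cols_mat_def image_iff)
  have "det (mat_adjoint (cols_mat n v)) * det (cols_mat n v) = 1"
    using onb_unitary(1)[OF v] det_mult[of "mat_adjoint (cols_mat n v)" n "cols_mat n v"] by simp
  then have "det (cols_mat n v) \<noteq> 0" by auto
  then have "lin_indpt (v ` {..<n})"
    using lin_dep_cols_imp_det_0[OF cols_mat_carrier, of v] cs by auto
  then have "basis (v ` {..<n})"
    using vc inj by (intro dim_li_is_basis) (auto simp: card_image dim_is_n)
  then show ?thesis using v by (simp add: orthonormal_basis_def onb_def)
qed

lemma eigenbasis_finsum_mat: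
  assumes A: "A \<in> carrier_mat n n" and v: "eigenbasis n A a v"
  shows "A = finsum_mat n (\<lambda>i. complex_of_real (a i) \<cdot>\<^sub>m rank_one (v i) (v i)) {..<n}"
    (is "A = ?F")
proof -
  have vo: "onb n v" using v by (simp add: eigenbasis_def)
  have vc: "v i \<in> carrier_vec n" if "i < n" for i using vo that by (simp add: onb_def)
  have r: "complex_of_real (a i) \<cdot>\<^sub>m rank_one (v i) (v i) \<in> carrier_mat n n" if "i \<in> {..<n}" for i
    using vc[of i] that by (auto simp: rank_one_def)
  have F: "?F \<in> carrier_mat n n" using finsum_mat_index[OF finite_lessThan r] by simp
  have Fi: "?F $$ (p, q) = (\<Sum>k<n. complex_of_real (a k) * (v k $ p * cnj (v k $ q)))"
    if pq: "p < n" "q < n" for p q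
  proof -
    have "?F $$ (p, q) = (\<Sum>k<n. (complex_of_real (a k) \<cdot>\<^sub>m rank_one (v k) (v k)) $$ (p, q))"
      using finsum_mat_index[OF finite_lessThan r] pq by simp
    also have "\<dots> = (\<Sum>k<n. complex_of_real (a k) * (v k $ p * cnj (v k $ q)))"
    proof (rule sum.cong)
      fix k assume "k \<in> {..<n}"
      then have "dim_vec (v k) = n" using vc[of k] by simp
      then show "(complex_of_real (a k) \<cdot>\<^sub>m rank_one (v k) (v k)) $$ (p, q)
          = complex_of_real (a k) * (v k $ p * cnj (v k $ q))"
        using pq by (simp add: rank_one_def)
    qed simp
    finally show ?thesis .
  qed
  show ?thesis
  proof (rule onb_mat_eqI[OF vo A F])
    fix j assume j: "j < n"
    have "?F *\<^sub>v v j = complex_of_real (a j) \<cdot>\<^sub>v v j"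
    proof (rule eq_vecI)
      fix p assume "p < dim_vec (complex_of_real (a j) \<cdot>\<^sub>v v j)"
      then have p: "p < n" using vc[OF j] by simp
      have "(?F *\<^sub>v v j) $ p = (\<Sum>q<n. \<Sum>k<n. complex_of_real (a k) * (v k $ p * cnj (v k $ q)) * v j $ q)"
        using F p Fi vc[OF j]
        by (auto simp: scalar_prod_def atLeast0LessThan sum_distrib_right intro!: sum.cong)
      also have "\<dots> = (\<Sum>k<n. \<Sum>q<n. complex_of_real (a k) * (v k $ p * cnj (v k $ q)) * v j $ q)"
        by (rule sum.swap)
      also have "\<dots> = (\<Sum>k<n. complex_of_real (a k) * v k $ p * (v j \<bullet>c v k))"
        using carrier_vecD[OF vc]
        by (auto simp: scalar_prod_def atLeast0LessThan sum_distrib_left mult_ac intro!: sum.cong)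
      also have "\<dots> = (\<Sum>k<n. if k = j then complex_of_real (a k) * v k $ p else 0)"
        using vo j by (intro sum.cong) (auto simp: onb_def simp del: conjugate_square_eq_0_vec)
      also have "\<dots> = complex_of_real (a j) * v j $ p" using j by simp
      finally show "(?F *\<^sub>v v j) $ p = (complex_of_real (a j) \<cdot>\<^sub>v v j) $ p"
        using p vc[OF j] by simp
    qed (use F vc[OF j] in simp)
    then show "A *\<^sub>v v j = ?F *\<^sub>v v j" using v j by (simp add: eigenbasis_def)
  qed
qed

text \<open>
  The square root is defined by a definite description, so uniqueness is the point. Let \<open>B\<close> be
  positive semidefinite with square \<open>M\<close>, let \<open>v\<close> be an eigenvector of \<open>M\<close> with eigenvalue
  \<open>s\<^sup>2 > 0\<close>, and put \<open>w = B v - s v\<close>. From \<open>(B + s)(B - s) v = 0\<close> it follows that \<open>B w = - s w\<close>, which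
  contradicts the positivity of \<open>B\<close> unless \<open>w = 0\<close>.
\<close>

lemma mat_sqrt_eqI:
  assumes M: "M \<in> carrier_mat n n" and v: "eigenbasis n M b v" and b: "\<And>i. i < n \<Longrightarrow> 0 < b i"
    and T: "T \<in> carrier_mat n n" and TH: "mat_adjoint T = T" and Tv: "eigenbasis n T (\<lambda>i. sqrt (b i)) v"
  shows "mat_sqrt M = T"
proof -
  have vo: "onb n v" using v by (simp add: eigenbasis_def)
  have vc: "v i \<in> carrier_vec n" if "i < n" for i using vo that by (simp add: onb_def)
  have TT: "T * T = M"
  proof (rule onb_mat_eqI[OF vo])
    fix i assume i: "i < n"
    have "(T * T) *\<^sub>v v i = complex_of_real (sqrt (b i)) \<cdot>\<^sub>v (T *\<^sub>v v i)"
      using T Tv vc[OF i] i by (simp add: assoc_mult_mat_vec[of _ n n _ n] eigenbasis_def mult_mat_vec[of _ n n])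
    also have "\<dots> = complex_of_real (sqrt (b i) * sqrt (b i)) \<cdot>\<^sub>v v i"
      using Tv i by (simp only: eigenbasis_def smult_smult_assoc of_real_mult)
    also have "\<dots> = M *\<^sub>v v i" using v i b[OF i] by (simp add: eigenbasis_def)
    finally show "(T * T) *\<^sub>v v i = M *\<^sub>v v i" .
  qed (use T M in auto)
  have psd: "positive_semidefinite T"
  proof -
    have "0 \<le> (T *\<^sub>v x) \<bullet>c x" if x: "x \<in> carrier_vec n" for x
    proof -
      have Tx: "T *\<^sub>v x \<in> carrier_vec n" using T x by auto
      have "(T *\<^sub>v x) \<bullet>c x = cnj ((T *\<^sub>v x) \<bullet>c x)"
        using hermitian_inner[OF T TH x x] cinner_commute[OF Tx x] by simp
      then have "Im ((T *\<^sub>v x) \<bullet>c x) = 0" by (simp add: complex_eq_iff)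
      moreover have "0 \<le> quad_form T x"
        unfolding eigenbasis_quad_form[OF T TH Tv x]
        using b by (intro sum_nonneg mult_nonneg_nonneg) (auto intro: less_imp_le)
      ultimately show ?thesis by (simp add: quad_form_def less_eq_complex_def)
    qed
    then show ?thesis using T TH by (auto simp: positive_semidefinite_def)
  qed
  have "B = T" if B: "positive_semidefinite B" "B * B = M" for B
  proof -
    have "dim_row B = n" using B(2) M by (metis carrier_matD(1) index_mult_mat(2))
    then have Bc: "B \<in> carrier_mat n n" using B(1) by (auto simp: positive_semidefinite_def)
    show ?thesis
    proof (rule onb_mat_eqI[OF vo Bc T])
      fix i assume i: "i < n"
      define s where "s = sqrt (b i)"
      have s: "0 < s" "s * s = b i" using b[OF i] by (simp_all add: s_def)
      define w where "w = B *\<^sub>v v i - complex_of_real s \<cdot>\<^sub>v v i"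
      have Bv: "B *\<^sub>v v i \<in> carrier_vec n" using Bc vc[OF i] by auto
      have w: "w \<in> carrier_vec n" using Bv vc[OF i] by (auto simp: w_def)
      have "B *\<^sub>v w = B *\<^sub>v (B *\<^sub>v v i) - complex_of_real s \<cdot>\<^sub>v (B *\<^sub>v v i)"
        unfolding w_def using Bc Bv vc[OF i]
        by (simp add: mult_minus_distrib_mat_vec[of _ n n] mult_mat_vec[of _ n n])
      also have "B *\<^sub>v (B *\<^sub>v v i) = complex_of_real (s * s) \<cdot>\<^sub>v v i"
        using Bc vc[OF i] v i s by (simp add: assoc_mult_mat_vec[of _ n n _ n, symmetric] B(2) eigenbasis_def)
      also have "complex_of_real (s * s) \<cdot>\<^sub>v v i - complex_of_real s \<cdot>\<^sub>v (B *\<^sub>v v i) = complex_of_real (- s) \<cdot>\<^sub>v w"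
        unfolding w_def using Bv Bc vc[OF i] by (intro eq_vecI) (auto simp: algebra_simps)
      finally have Bw: "B *\<^sub>v w = complex_of_real (- s) \<cdot>\<^sub>v w" .
      have "0 \<le> (B *\<^sub>v w) \<bullet>c w"
        using B(1) w Bc by (auto simp: positive_semidefinite_def)
      then have "0 \<le> - s * norm_sq w"
        unfolding Bw cinner_smult_left[OF w w] cinner_self by (simp add: less_eq_complex_def)
      then have "\<not> 0 < norm_sq w" using s by (simp add: mult_le_0_iff)
      then have "w = 0\<^sub>v n" using norm_sq_pos[OF w] by blast
      then have "B *\<^sub>v v i = complex_of_real s \<cdot>\<^sub>v v i"
      proof -
        assume w0: "w = 0\<^sub>v n"
        show ?thesis
        proof (rule eq_vecI)
          fix k assume "k < dim_vec (complex_of_real s \<cdot>\<^sub>v v i)"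
          then have k: "k < n" using vc[OF i] by simp
          have "w $ k = 0" using w0 k by simp
          then show "(B *\<^sub>v v i) $ k = (complex_of_real s \<cdot>\<^sub>v v i) $ k"
            using k Bv vc[OF i] Bc by (simp add: w_def del: index_mult_mat_vec)
        qed (use Bc vc[OF i] in simp)
      qed
      then show "B *\<^sub>v v i = T *\<^sub>v v i" using Tv i by (simp add: eigenbasis_def s_def)
    qed
  qed
  then show ?thesis
    unfolding mat_sqrt_def by - (rule the_equality, simp add: psd TT, blast)
qed

lemma spectral_representation:
  assumes S: "S \<in> carrier_mat d d" and V: "V \<in> carrier_mat d d"
    and Sv: "eigenbasis d S a v" and Bv: "eigenbasis d (V * mat_adjoint V) b v"
    and b: "\<And>i. i < d \<Longrightarrow> 0 < b i"
  shows "\<exists>v. orthonormal_basis d v \<and>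
    S = finsum_mat d (\<lambda>i. complex_of_real (a i) \<cdot>\<^sub>m rank_one (v i) (v i)) {..<d} \<and>
    mat_abs (mat_adjoint V) = finsum_mat d (\<lambda>i. complex_of_real (sqrt (b i)) \<cdot>\<^sub>m rank_one (v i) (v i)) {..<d}"
proof -
  have vo: "onb d v" using Sv by (simp add: eigenbasis_def)
  have c: "V * mat_adjoint V \<in> carrier_mat d d" using V by (intro mult_carrier_mat) auto
  obtain T where T: "T \<in> carrier_mat d d" "mat_adjoint T = T" "eigenbasis d T (\<lambda>i. sqrt (b i)) v"
    using onb_diagonal[OF vo] by metis
  have "mat_abs (mat_adjoint V) = T"
    unfolding mat_abs_mat_adjoint using c Bv b T by (rule mat_sqrt_eqI)
  then show ?thesis
    using onb_imp_orthonormal_basis[OF vo] eigenbasis_finsum_mat[OF S Sv] eigenbasis_finsum_mat[OF T(1,3)]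
    by blast
qed

lemma eigenbasis_inverse:
  assumes M: "M \<in> carrier_mat n n" and N: "N \<in> carrier_mat n n" and NM: "N * M = 1\<^sub>m n"
    and v: "eigenbasis n M a v" and a: "\<And>i. i < n \<Longrightarrow> a i \<noteq> 0"
  shows "eigenbasis n N (\<lambda>i. 1 / a i) v"
proof -
  have "N *\<^sub>v v i = complex_of_real (1 / a i) \<cdot>\<^sub>v v i" if i: "i < n" for i
  proof -
    have vi: "v i \<in> carrier_vec n" by (rule eigenbasis_carrier[OF v i])
    have "v i = N *\<^sub>v (M *\<^sub>v v i)"
      using M N NM vi by (simp add: assoc_mult_mat_vec[of _ n n _ n, symmetric])
    also have "\<dots> = complex_of_real (a i) \<cdot>\<^sub>v (N *\<^sub>v v i)"
      using v i N vi by (simp add: eigenbasis_def mult_mat_vec[of _ n n])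
    finally have "complex_of_real (1 / a i) \<cdot>\<^sub>v v i
        = complex_of_real (1 / a i) \<cdot>\<^sub>v (complex_of_real (a i) \<cdot>\<^sub>v (N *\<^sub>v v i))" by simp
    also have "\<dots> = N *\<^sub>v v i" using a[OF i] by (simp add: smult_smult_assoc)
    finally show ?thesis by simp
  qed
  then show ?thesis using v by (simp add: eigenbasis_def)
qed

text \<open>
  Reciprocals reverse the order, which is where the increasing rearrangement of \<open>\<gamma>\<close> comes from.
\<close>

lemma inverse_spectrum:
  assumes M: "positive_definite M" "M \<in> carrier_mat n n" and N: "N \<in> carrier_mat n n" and NM: "N * M = 1\<^sub>m n"
    and g: "spectrum_is M g" "sorted_wrt (\<ge>) g"
  shows "spectrum_is N (map (\<lambda>x. 1 / x) (rev g))" and "sorted_wrt (\<ge>) (map (\<lambda>x. 1 / x) (rev g))"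
proof -
  have len: "length g = n" by (rule spectrum_is_length[OF M(2) g(1)])
  have pos: "0 < x" if "x \<in> set g" for x
    by (rule positive_definite_spectrum_pos[OF M g(1) that])
  obtain v where v: "eigenbasis n M (\<lambda>i. g ! i) v"
    using hermitian_spectral_theorem[OF M(2) positive_definiteD(1)[OF M] g(1)] by metis
  have "g ! i \<noteq> 0" if "i < n" for i using pos[of "g ! i"] that len by auto
  then have "spectrum_is N (map (\<lambda>i. 1 / g ! i) [0..<n])"
    using eigenbasis_spectrum_is[OF N eigenbasis_inverse[OF M(2) N NM v]] by blast
  also have "map (\<lambda>i. 1 / g ! i) [0..<n] = map (\<lambda>x. 1 / x) g"
    using len by (intro nth_equalityI) auto
  finally show "spectrum_is N (map (\<lambda>x. 1 / x) (rev g))"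
    using spectrum_is_mset_cong[of "map (\<lambda>x. 1 / x) (rev g)" "map (\<lambda>x. 1 / x) g"] by simp
  have "sorted_wrt (\<le>) (rev g)" using g(2) by (simp add: sorted_wrt_ge_iff)
  then show "sorted_wrt (\<ge>) (map (\<lambda>x. 1 / x) (rev g))"
    unfolding sorted_wrt_map
    by (rule sorted_wrt_mono_rel[rotated]) (use pos in \<open>auto intro!: divide_left_mono mult_pos_pos\<close>)
qed

text \<open>
  If \<open>V\<^sup>* V w = g w\<close>, then \<open>V w / \<surd>g\<close> is an eigenvector of \<open>V V\<^sup>*\<close>, as in the singular value
  decomposition; if \<open>w\<close> also is an eigenvector of \<open>V\<^sup>* S V\<close>, then cancelling \<open>V\<^sup>*\<close> in
  \<open>V\<^sup>* S V w = a g w = a V\<^sup>* V w\<close> shows that \<open>V w\<close> is one of \<open>S\<close>.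
\<close>

lemma eigenbasis_transport:
  assumes S: "S \<in> carrier_mat n n" and V: "V \<in> carrier_mat n n"
    and W: "W \<in> carrier_mat n n" "W * V = 1\<^sub>m n" "V * W = 1\<^sub>m n"
    and Gw: "eigenbasis n (mat_adjoint V * V) g w"
    and Cw: "eigenbasis n (mat_adjoint V * S * V) (\<lambda>i. a i * g i) w"
    and g: "\<And>i. i < n \<Longrightarrow> 0 < g i"
  obtains v where "eigenbasis n (V * mat_adjoint V) g v" and "eigenbasis n S a v"
proof -
  have c: "mat_adjoint V \<in> carrier_mat n n" "mat_adjoint W \<in> carrier_mat n n" using V W by simp_all
  have WV: "mat_adjoint W * mat_adjoint V = 1\<^sub>m n"
    using mat_adjoint_mult[OF V W(1)] W(3) by simp
  have inj: "p = q" if "mat_adjoint V *\<^sub>v p = mat_adjoint V *\<^sub>v q" "p \<in> carrier_vec n" "q \<in> carrier_vec n" for p q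
  proof -
    have "mat_adjoint W *\<^sub>v (mat_adjoint V *\<^sub>v x) = x" if "x \<in> carrier_vec n" for x
      using that c WV by (simp add: assoc_mult_mat_vec[of _ n n _ n, symmetric])
    then show ?thesis using that by metis
  qed
  have wo: "onb n w" using Gw by (simp add: eigenbasis_def)
  have wc: "w i \<in> carrier_vec n" if "i < n" for i using wo that by (simp add: onb_def)
  have Vw: "V *\<^sub>v w i \<in> carrier_vec n" if "i < n" for i using V wc[OF that] by auto
  have VVw: "mat_adjoint V *\<^sub>v (V *\<^sub>v w i) = complex_of_real (g i) \<cdot>\<^sub>v w i" if "i < n" for i
    using Gw that assoc_mult_mat_vec[OF c(1) V wc[OF that]] by (simp add: eigenbasis_def)
  have Bw: "(V * mat_adjoint V) *\<^sub>v (V *\<^sub>v w i) = complex_of_real (g i) \<cdot>\<^sub>v (V *\<^sub>v w i)" if i: "i < n" for i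
    using VVw[OF i] V c Vw[OF i] wc[OF i] by (simp add: assoc_mult_mat_vec[of _ n n _ n] mult_mat_vec[of _ n n])
  have Sw: "S *\<^sub>v (V *\<^sub>v w i) = complex_of_real (a i) \<cdot>\<^sub>v (V *\<^sub>v w i)" if i: "i < n" for i
  proof (rule inj)
    have "mat_adjoint V *\<^sub>v (S *\<^sub>v (V *\<^sub>v w i)) = (mat_adjoint V * S * V) *\<^sub>v w i"
      using S V c wc[OF i] Vw[OF i]
      by (simp add: assoc_mult_mat_vec[of _ n n _ n] mult_carrier_mat[of _ n n _ n])
    also have "\<dots> = complex_of_real (a i) \<cdot>\<^sub>v (mat_adjoint V *\<^sub>v (V *\<^sub>v w i))"
      using Cw i VVw[OF i] by (simp add: eigenbasis_def smult_smult_assoc)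
    also have "\<dots> = mat_adjoint V *\<^sub>v (complex_of_real (a i) \<cdot>\<^sub>v (V *\<^sub>v w i))"
      using c Vw[OF i] by (simp add: mult_mat_vec[of _ n n])
    finally show "mat_adjoint V *\<^sub>v (S *\<^sub>v (V *\<^sub>v w i)) = mat_adjoint V *\<^sub>v (complex_of_real (a i) \<cdot>\<^sub>v (V *\<^sub>v w i))" .
  qed (use S Vw[OF i] in auto)
  define v where "v i = complex_of_real (1 / sqrt (g i)) \<cdot>\<^sub>v (V *\<^sub>v w i)" for i
  have vc: "v i \<in> carrier_vec n" if "i < n" for i using Vw[OF that] by (simp add: v_def)
  have vo: "onb n v"
    unfolding onb_def
  proof (intro conjI allI impI)
    fix i j assume ij: "i < n" "j < n"
    have "(V *\<^sub>v w i) \<bullet>c (V *\<^sub>v w j) = w i \<bullet>c (complex_of_real (g j) \<cdot>\<^sub>v w j)"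
      using adjoint_inner[OF V wc[OF ij(1)] Vw[OF ij(2)]] VVw[OF ij(2)] by simp
    also have "\<dots> = complex_of_real (g j) * (if i = j then 1 else 0)"
      using cinner_smult_right[OF wc[OF ij(1)] wc[OF ij(2)]] wo ij by (simp add: onb_def del: conjugate_square_eq_0_vec)
    finally have e: "v i \<bullet>c v j = complex_of_real (1 / sqrt (g i)) * (complex_of_real (1 / sqrt (g j)) * (complex_of_real (g j) * (if i = j then 1 else 0)))"
      unfolding v_def using Vw[OF ij(1)] Vw[OF ij(2)]
      by (simp add: cinner_smult_left[of _ n] cinner_smult_right[of _ n] del: conjugate_square_eq_0_vec)
    have "complex_of_real (1 / sqrt (g j)) * (complex_of_real (1 / sqrt (g j)) * complex_of_real (g j))
        = complex_of_real (1 / sqrt (g j) * (1 / sqrt (g j) * g j))"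
      by (simp only: of_real_mult)
    also have "1 / sqrt (g j) * (1 / sqrt (g j) * g j) = 1"
      using g[OF ij(2)] by (simp add: field_simps)
    finally have "complex_of_real (1 / sqrt (g j)) * (complex_of_real (1 / sqrt (g j)) * complex_of_real (g j)) = 1"
      by simp
    then show "v i \<bullet>c v j = (if i = j then 1 else 0)" unfolding e by (cases "i = j") simp_all
  qed (rule vc)
  show ?thesis
  proof (rule that)
    have "A *\<^sub>v v i = complex_of_real e \<cdot>\<^sub>v v i"
      if "A *\<^sub>v (V *\<^sub>v w i) = complex_of_real e \<cdot>\<^sub>v (V *\<^sub>v w i)" "A \<in> carrier_mat n n" "i < n" for A e i
      using that Vw[OF that(3)] by (simp add: v_def mult_mat_vec[of _ n n] smult_smult_assoc mult.commute)
    then show "eigenbasis n (V * mat_adjoint V) g v" "eigenbasis n S a v"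
      using vo Bw Sw S V c by (auto simp: eigenbasis_def)
  qed
qed

section \<open>Rearrangements and log-majorization\<close>

lemma rearr_dec_vec_of_list: "rearr_dec (vec_of_list xs) = vec_of_list (rev (sort xs))"
  by (simp add: rearr_dec_def list_vec)

text \<open>
  This reduces a log-majorization with an unordered left-hand side to products over
  arbitrary index sets, the form in which the Lidskii inequality applies.
\<close>

lemma rev_sort_prefix_prod:
  fixes xs :: "real list"
  assumes "k \<le> length xs"
  obtains J where "J \<subseteq> {..<length xs}" and "card J = k"
    and "(\<Prod>i<k. rev (sort xs) ! i) = (\<Prod>j\<in>J. xs ! j)"
proof -
  have "mset (rev (sort xs)) = mset xs" by simp
  then obtain p where p: "p permutes {..<length xs}" and e: "permute_list p xs = rev (sort xs)"
    by (rule mset_eq_permutation)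
  have inj: "inj_on p {..<k}" using permutes_inj[OF p] by (rule inj_on_subset) simp
  have "rev (sort xs) ! i = xs ! p i" if "i < k" for i
    unfolding e[symmetric] using permute_list_nth[OF p, of i] that assms by simp
  then have "(\<Prod>i<k. rev (sort xs) ! i) = (\<Prod>i<k. xs ! p i)" by simp
  also have "\<dots> = (\<Prod>j\<in>p ` {..<k}. xs ! j)"
    using prod.reindex[OF inj, of "\<lambda>j. xs ! j"] by (simp only: o_def)
  finally have "(\<Prod>i<k. rev (sort xs) ! i) = (\<Prod>j\<in>p ` {..<k}. xs ! j)" .
  moreover have "p ` {..<k} \<subseteq> {..<length xs}" 
    using permutes_image[OF p] image_mono[of "{..<k}" "{..<length xs}" p] assms by simp
  moreover have "card (p ` {..<k}) = k" using inj by (simp add: card_image)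
  ultimately show ?thesis using that by blast
qed

lemma component_mult_vec_of_list:
  assumes "length xs = length ys"
  shows "component_mult (vec_of_list xs) (vec_of_list ys) = vec_of_list (map2 (*) xs ys)"
  using assms by (intro eq_vecI) (auto simp: component_mult_def index_vec_of_list)

lemma log_majorized_listI:
  assumes "length xs = length ys" and "\<forall>x\<in>set xs. 0 \<le> x" and "\<forall>y\<in>set ys. 0 \<le> y"
    and "sorted_wrt (\<ge>) ys" and "prod_list xs = prod_list ys"
    and "\<And>k. k \<le> length xs \<Longrightarrow> (\<Prod>i<k. rev (sort xs) ! i) \<le> (\<Prod>i<k. ys ! i)"
  shows "vec_of_list xs \<prec>\<^sub>log vec_of_list ys"
proof -
  have "prod_list zs = (\<Prod>i<length zs. zs ! i)" for zs :: "real list"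
    by (simp add: prod.list_conv_set_nth atLeast0LessThan)
  then show ?thesis
    using assms rev_sort_eqI[OF refl assms(4)]
    by (auto simp: log_majorized_def rearr_dec_vec_of_list vec_of_list_index)
qed

lemma prod_list_map2_mult:
  "length xs = length ys \<Longrightarrow> prod_list (map2 (*) xs ys) = prod_list xs * prod_list (ys :: real list)"
  by (induction xs ys rule: list_induct2) simp_all

section \<open>Eigenvalue bounds for a congruence and their equality cases\<close>

text \<open>
  The upper bound is the Lidskii inequality for \<open>K = S\<close>, \<open>R = V\<close> and an initial segment \<open>J\<close>. The lower bound is
  the same inequality for \<open>K = V\<^sup>* S V\<close> and \<open>R = V\<^sup>-\<^sup>1\<close>, that is, with \<open>S\<close> written as a congruence of
  \<open>V\<^sup>* S V\<close>, and an arbitrary \<open>J\<close>. The two equality cases are the rigidity theorem for the pairs \<open>S, V V\<^sup>*\<close>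
  and \<open>(V\<^sup>* V)\<^sup>-\<^sup>1, V\<^sup>* S V\<close>, whose products are similar to \<open>V\<^sup>* S V\<close> and to \<open>S\<close>.
\<close>

theorem theorem5p1:
  fixes d :: nat and S V :: "complex mat" and \<gamma> :: "real vec"
  assumes "S \<in> carrier_mat d d" and "positive_definite S"
    and "\<gamma> \<in> pos_dec_vecs d"
    and "V \<in> carrier_mat d d" and "invertible_mat V"
    and "eigvals_dec (mat_adjoint V * V) = \<gamma>"
  shows
    "component_mult (eigvals_dec S) (rearr_inc \<gamma>) \<prec>\<^sub>log eigvals_dec (mat_adjoint V * S * V) \<and>
     eigvals_dec (mat_adjoint V * S * V) \<prec>\<^sub>log component_mult (eigvals_dec S) \<gamma> \<and>
     component_mult (eigvals_dec S) \<gamma> \<in> pos_dec_vecs d \<and>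
     (eigvals_dec (mat_adjoint V * S * V)
        = rearr_dec (component_mult (eigvals_dec S) (rearr_inc \<gamma>)) \<longrightarrow>
      (\<exists>v. orthonormal_basis d v \<and>
        S = finsum_mat d
              (\<lambda>i. complex_of_real (eigvals_dec S $ i) \<cdot>\<^sub>m rank_one (v i) (v i)) {..<d} \<and>
        mat_abs (mat_adjoint V) = finsum_mat d
              (\<lambda>i. complex_of_real (sqrt (\<gamma> $ (d - 1 - i))) \<cdot>\<^sub>m rank_one (v i) (v i)) {..<d})) \<and>
     (eigvals_dec (mat_adjoint V * S * V) = component_mult (eigvals_dec S) \<gamma> \<longrightarrow>
      (\<exists>v. orthonormal_basis d v \<and>
        S = finsum_mat d
              (\<lambda>i. complex_of_real (eigvals_dec S $ i) \<cdot>\<^sub>m rank_one (v i) (v i)) {..<d} \<and>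
        mat_abs (mat_adjoint V) = finsum_mat d
              (\<lambda>i. complex_of_real (sqrt (\<gamma> $ i)) \<cdot>\<^sub>m rank_one (v i) (v i)) {..<d}))"
proof -
  note S = assms(1) and pdS = assms(2) and V = assms(4)
  have SH: "mat_adjoint S = S" by (rule positive_definiteD(1)[OF pdS S])
  obtain W where "inverts_mat V W" "inverts_mat W V" using assms(5) by (auto simp: invertible_mat_def)
  then have W: "W \<in> carrier_mat d d" "W * V = 1\<^sub>m d" "V * W = 1\<^sub>m d"
    using V by (auto simp: inverts_mat_def)
      (metis carrier_matD carrier_matI index_mult_mat(2,3) index_one_mat(2,3))+
  have Vc: "mat_adjoint V \<in> carrier_mat d d" and Wc: "mat_adjoint W \<in> carrier_mat d d"
    using V W by simp_all
  have WVc: "mat_adjoint W * mat_adjoint V = 1\<^sub>m d" and VWc: "mat_adjoint V * mat_adjoint W = 1\<^sub>m d"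
    using mat_adjoint_mult[OF V W(1), symmetric] mat_adjoint_mult[OF W(1) V, symmetric]
    by (simp_all only: W(2,3) mat_adjoint_one)
  define G where "G = mat_adjoint V * V"
  define B where "B = V * mat_adjoint V"
  define C where "C = mat_adjoint V * S * V"
  have carr: "G \<in> carrier_mat d d" "B \<in> carrier_mat d d" "C \<in> carrier_mat d d"
    using S V Vc by (simp_all add: G_def B_def C_def mult_carrier_mat[of _ d d _ d])
  have pdG: "positive_definite G" unfolding G_def by (rule positive_definite_gram[OF V W(1,2)])
  have pdB: "positive_definite B"
    using positive_definite_gram[OF Vc Wc WVc] by (simp add: B_def mat_adjoint_mat_adjoint)
  have pdC: "positive_definite C" unfolding C_def by (rule positive_definite_sandwich[OF pdS S V W(1,2)])
  have GH: "mat_adjoint G = G" and BH: "mat_adjoint B = B" and CH: "mat_adjoint C = C"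
    using positive_definiteD(1) pdG pdB pdC carr by blast+
  obtain \<alpha> where \<alpha>: "spectrum_is S \<alpha>" "sorted_wrt (\<ge>) \<alpha>" using hermitian_spectrum[OF S SH] by metis
  obtain g where g: "spectrum_is G g" "sorted_wrt (\<ge>) g" using hermitian_spectrum[OF carr(1) GH] by metis
  obtain \<mu> where \<mu>: "spectrum_is C \<mu>" "sorted_wrt (\<ge>) \<mu>" using hermitian_spectrum[OF carr(3) CH] by metis
  have len: "length \<alpha> = d" "length g = d" "length \<mu> = d"
    using spectrum_is_length S carr \<alpha>(1) g(1) \<mu>(1) by blast+
  have pos: "\<forall>x\<in>set \<alpha>. 0 < x" "\<forall>x\<in>set g. 0 < x" "\<forall>x\<in>set \<mu>. 0 < x"
    using positive_definite_spectrum_pos pdS pdG pdC S carr \<alpha>(1) g(1) \<mu>(1) by blast+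
  have eS: "eigvals_dec S = vec_of_list \<alpha>" by (rule eigvals_dec_eqI[OF \<alpha>])
  have eC: "eigvals_dec C = vec_of_list \<mu>" by (rule eigvals_dec_eqI[OF \<mu>])
  have e\<gamma>: "\<gamma> = vec_of_list g" using eigvals_dec_eqI[OF g] assms(6) by (simp add: G_def)
  have sg: "sort g = rev g" using rev_sort_eqI[OF refl g(2)] by (metis rev_rev_ident)
  have inc: "rearr_inc \<gamma> = vec_of_list (rev g)"
    by (simp add: e\<gamma> rearr_inc_def list_vec sg)
  \<comment> \<open>the two bounds, as lists of products of eigenvalues\<close>
  define lo where "lo = map2 (*) \<alpha> (rev g)"
  define hi where "hi = map2 (*) \<alpha> g"
  have clo: "component_mult (eigvals_dec S) (rearr_inc \<gamma>) = vec_of_list lo"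
    unfolding eS inc lo_def by (rule component_mult_vec_of_list) (simp add: len)
  have chi: "component_mult (eigvals_dec S) \<gamma> = vec_of_list hi"
    unfolding eS e\<gamma> hi_def by (rule component_mult_vec_of_list) (simp add: len)
  have lenlh: "length lo = d" "length hi = d" by (simp_all add: lo_def hi_def len)
  have poslh: "\<forall>x\<in>set lo. 0 < x" "\<forall>x\<in>set hi. 0 < x"
    unfolding lo_def hi_def using pos
    by (auto simp: set_zip intro!: mult_pos_pos) (metis len(1,2) length_rev nth_mem set_rev)+
  have nth: "lo ! i = \<alpha> ! i * g ! (d - 1 - i)" "hi ! i = \<alpha> ! i * g ! i" if "i < d" for i
    using that len by (simp_all add: lo_def hi_def rev_nth)
  have gpos: "0 < g ! i" if "i < d" for i using pos(2) len that by simp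
  have \<alpha>pos: "0 < \<alpha> ! i" if "i < d" for i using pos(1) len that by simp
  have shi: "sorted_wrt (\<ge>) hi"
  proof -
    have "hi ! k \<le> hi ! i" if "i < k" "k < d" for i k
      using that sorted_wrt_ge_nth[OF \<alpha>(2), of i k] sorted_wrt_ge_nth[OF g(2), of i k] len
        gpos[of k] \<alpha>pos[of i] by (simp add: nth mult_mono)
    then show ?thesis by (simp add: sorted_wrt_iff_nth_less lenlh)
  qed
  have sB: "spectrum_is B g"
    using similar_spectrum_is[OF similar_mat_mult_commute[OF Vc Wc V VWc]] g(1)
    by (simp add: G_def B_def)
  have sSB: "spectrum_is (S * B) \<mu>"
  proof -
    have "similar_mat (mat_adjoint V * (S * V)) (S * V * mat_adjoint V)"
      by (rule similar_mat_mult_commute[OF Vc Wc _ VWc]) (use S V in auto)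
    moreover have "mat_adjoint V * (S * V) = C" "S * V * mat_adjoint V = S * B"
      using S V Vc by (simp_all add: C_def B_def assoc_mult_mat[of _ d d _ d _ d])
    ultimately show ?thesis using \<mu>(1) similar_spectrum_is by metis
  qed
  have prod: "prod_list \<mu> = prod_list \<alpha> * prod_list g"
  proof -
    have "det C = det S * det G"
      using S V Vc by (simp add: C_def G_def det_mult[of _ d] mult_carrier_mat[of _ d d _ d])
    then have "complex_of_real (prod_list \<mu>) = complex_of_real (prod_list \<alpha> * prod_list g)"
      using spectrum_is_det[OF S \<alpha>(1)] spectrum_is_det[OF carr(1) g(1)] spectrum_is_det[OF carr(3) \<mu>(1)]
      by simp
    then show ?thesis using of_real_eq_iff by blast
  qed
  have WW: "mat_adjoint W * W * B = 1\<^sub>m d"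
  proof -
    have "mat_adjoint W * W * B = mat_adjoint W * (W * (V * mat_adjoint V))"
      unfolding B_def using Wc W(1) V Vc by (intro assoc_mult_mat) auto
    also have "W * (V * mat_adjoint V) = (W * V) * mat_adjoint V"
      using W(1) V Vc by (intro assoc_mult_mat[symmetric]) auto
    finally show ?thesis by (simp only: W(2) left_mult_one_mat[OF Vc] WVc)
  qed
  have cWW: "mat_adjoint W * W \<in> carrier_mat d d" using Wc W(1) by (rule mult_carrier_mat)
  have sW: "spectrum_is (mat_adjoint W * W) (map (\<lambda>x. 1 / x) (rev g))"
    and soW: "sorted_wrt (\<ge>) (map (\<lambda>x. 1 / x) (rev g))"
    using inverse_spectrum[OF pdB carr(2) cWW WW sB g(2)] by blast+
  have WCW: "mat_adjoint W * C * W = S"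
  proof -
    have "mat_adjoint W * C * W = (mat_adjoint W * mat_adjoint V) * S * (V * W)"
      using S V W Vc Wc by (simp add: C_def assoc_mult_mat[of _ d d _ d _ d] mult_carrier_mat[of _ d d _ d])
    then show ?thesis using S WVc W by simp
  qed
  have low: "vec_of_list lo \<prec>\<^sub>log vec_of_list \<mu>"
  proof (rule log_majorized_listI)
    show "prod_list lo = prod_list \<mu>"
      using len prod by (simp add: lo_def prod_list_map2_mult)
    fix k assume "k \<le> length lo"
    then obtain J where J: "J \<subseteq> {..<d}" "card J = k"
      and e: "(\<Prod>i<k. rev (sort lo) ! i) = (\<Prod>j\<in>J. lo ! j)"
      using rev_sort_prefix_prod[of k lo] lenlh by metis
    have "(\<Prod>j\<in>J. \<alpha> ! j) \<le> (\<Prod>j\<in>J. map (\<lambda>x. 1 / x) (rev g) ! j) * (\<Prod>i<card J. \<mu> ! i)"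
      by (rule multiplicative_lidskii[OF pdC carr(3) W(1) V W(3) \<mu> sW soW _ \<alpha>(2) J(1)])
        (simp add: WCW \<alpha>(1))
    moreover have "0 \<le> (\<Prod>j\<in>J. g ! (d - 1 - j))"
      using J gpos by (intro prod_nonneg) (auto intro!: less_imp_le)
    ultimately have "(\<Prod>j\<in>J. \<alpha> ! j) * (\<Prod>j\<in>J. g ! (d - 1 - j))
        \<le> (\<Prod>j\<in>J. map (\<lambda>x. 1 / x) (rev g) ! j) * (\<Prod>i<card J. \<mu> ! i) * (\<Prod>j\<in>J. g ! (d - 1 - j))"
      by (rule mult_right_mono)
    also have "\<dots> = (\<Prod>j\<in>J. map (\<lambda>x. 1 / x) (rev g) ! j * g ! (d - 1 - j)) * (\<Prod>i<k. \<mu> ! i)"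
      by (simp add: prod.distrib J(2))
    also have "(\<Prod>j\<in>J. map (\<lambda>x. 1 / x) (rev g) ! j * g ! (d - 1 - j)) = 1"
    proof (rule prod.neutral, rule ballI)
      fix j assume "j \<in> J"
      then have "j < d" "0 < g ! (d - 1 - j)" using J gpos[of "d - 1 - j"] by auto
      then show "map (\<lambda>x. 1 / x) (rev g) ! j * g ! (d - 1 - j) = 1"
        using len by (simp add: rev_nth)
    qed
    also have "(\<Prod>j\<in>J. \<alpha> ! j) * (\<Prod>j\<in>J. g ! (d - 1 - j)) = (\<Prod>j\<in>J. lo ! j)"
      unfolding prod.distrib[symmetric] using J nth by (intro prod.cong) auto
    finally show "(\<Prod>i<k. rev (sort lo) ! i) \<le> (\<Prod>i<k. \<mu> ! i)" by (simp add: e)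
  qed (use poslh pos lenlh len \<mu> in \<open>auto intro: less_imp_le\<close>)
  have high: "vec_of_list \<mu> \<prec>\<^sub>log vec_of_list hi"
  proof (rule log_majorized_listI)
    show "prod_list \<mu> = prod_list hi"
      using len prod by (simp add: hi_def prod_list_map2_mult)
    fix k assume k: "k \<le> length \<mu>"
    have "(\<Prod>j\<in>{..<k}. \<mu> ! j) \<le> (\<Prod>j\<in>{..<k}. g ! j) * (\<Prod>i<card {..<k}. \<alpha> ! i)"
      using k len \<mu>(1) g(1) unfolding C_def G_def
      by (intro multiplicative_lidskii[OF pdS S V W(1,2) \<alpha> _ g(2) _ \<mu>(2)]) auto
    also have "\<dots> = (\<Prod>i<k. hi ! i)"
      unfolding card_lessThan prod.distrib[symmetric] using k len nth by (intro prod.cong) auto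
    finally show "(\<Prod>i<k. rev (sort \<mu>) ! i) \<le> (\<Prod>i<k. hi ! i)"
      using rev_sort_eqI[OF refl \<mu>(2)] by simp
  qed (use poslh pos lenlh len shi in \<open>auto intro: less_imp_le\<close>)
  have mem: "vec_of_list hi \<in> pos_dec_vecs d"
    unfolding pos_dec_vecs_def mem_Collect_eq vec_of_list_index
  proof (intro conjI allI impI)
    show "vec_of_list hi \<in> carrier_vec d" by (rule carrier_vecI) (simp add: lenlh)
    show "0 < hi ! i" if "i < d" for i using poslh(2) that lenlh by simp
    show "hi ! j \<le> hi ! i" if "j < d" "i \<le> j" for i j
      using sorted_wrt_ge_nth[OF shi that(2)] that(1) lenlh by simp
  qed
  have case_low: "\<exists>v. orthonormal_basis d v \<and>
        S = finsum_mat d (\<lambda>i. complex_of_real (\<alpha> ! i) \<cdot>\<^sub>m rank_one (v i) (v i)) {..<d} \<and>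
        mat_abs (mat_adjoint V) = finsum_mat d
              (\<lambda>i. complex_of_real (sqrt (g ! (d - 1 - i))) \<cdot>\<^sub>m rank_one (v i) (v i)) {..<d}"
    if eq: "vec_of_list \<mu> = rearr_dec (vec_of_list lo)"
  proof -
    have "\<mu> = rev (sort lo)" using eq by (metis list_vec rearr_dec_vec_of_list)
    then have sClo: "spectrum_is C lo" using \<mu>(1) spectrum_is_mset_cong[of lo \<mu>] by simp
    \<comment> \<open>\<open>Y\<close> is the inverse of \<open>V\<^sup>* V\<close>, and \<open>Y C\<close> is similar to \<open>S\<close>\<close>
    define Y where "Y = W * mat_adjoint W"
    define ys where "ys = map (\<lambda>x. 1 / x) (rev g)"
    have Y: "Y \<in> carrier_mat d d" using W Wc by (simp add: Y_def)
    have YH: "mat_adjoint Y = Y"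
      using mat_adjoint_mult[OF W(1) Wc] by (simp add: Y_def mat_adjoint_mat_adjoint)
    have YG: "Y * G = 1\<^sub>m d"
    proof -
      have "Y * G = W * ((mat_adjoint W * mat_adjoint V) * V)"
        using W V Vc Wc by (simp add: Y_def G_def assoc_mult_mat[of _ d d _ d _ d] mult_carrier_mat[of _ d d _ d])
      then show ?thesis using W V WVc by simp
    qed
    have GY: "G * Y = 1\<^sub>m d" by (rule mat_mult_left_right_inverse[OF Y carr(1) YG])
    have sY: "spectrum_is Y ys" "sorted_wrt (\<ge>) ys"
      using inverse_spectrum[OF pdG carr(1) Y YG g] by (simp_all add: ys_def)
    have yspos: "\<forall>y\<in>set ys. 0 < y" using pos(2) by (simp add: ys_def)
    have lenys: "length ys = d" by (simp add: ys_def len)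
    have ysn: "ys ! i = 1 / g ! (d - 1 - i)" if "i < d" for i
      using that len by (simp add: ys_def rev_nth)
    have mm: "map2 (*) ys lo = \<alpha>"
    proof (rule nth_equalityI)
      fix i assume "i < length (map2 (*) ys lo)"
      then have i: "i < d" by (simp add: lenys lenlh)
      then show "map2 (*) ys lo ! i = \<alpha> ! i"
        using gpos[of "d - 1 - i"] by (simp add: lenys lenlh ysn nth)
    qed (simp add: lenys lenlh len)
    have "spectrum_is (Y * C) \<alpha>"
    proof -
      have "Y * C = W * ((mat_adjoint W * mat_adjoint V) * (S * V))"
        using W V S Vc Wc
        by (simp add: Y_def C_def assoc_mult_mat[of _ d d _ d _ d] mult_carrier_mat[of _ d d _ d])
      then have YC: "Y * C = W * (S * V)" using WVc S V by simp
      have "similar_mat (W * (S * V)) (S * V * W)"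
        by (rule similar_mat_mult_commute[OF W(1) V _ W(2)]) (use S V in auto)
      moreover have "S * V * W = S" using S V W by simp
      ultimately show ?thesis using YC \<alpha>(1) similar_spectrum_is by metis
    qed
    then obtain w where w: "eigenbasis d Y (\<lambda>i. ys ! i) w" "eigenbasis d C (\<lambda>i. lo ! i) w"
      using product_spectrum_rigidity[OF Y YH sY(1) carr(3) CH sClo _ sY(2) yspos poslh(1)]
        mm \<alpha>(2) by metis
    have grev: "0 < g ! (d - 1 - i)" if "i < d" for i using that gpos by simp
    have ysnz: "ys ! i \<noteq> 0" if "i < d" for i using that gpos[of "d - 1 - i"] by (simp add: ysn)
    have "eigenbasis d G (\<lambda>i. 1 / ys ! i) w"
      by (rule eigenbasis_inverse[OF Y carr(1) GY w(1) ysnz])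
    then have Gw: "eigenbasis d G (\<lambda>i. g ! (d - 1 - i)) w" by (simp add: eigenbasis_def ysn)
    have Cw: "eigenbasis d C (\<lambda>i. \<alpha> ! i * g ! (d - 1 - i)) w"
      using w(2) by (simp add: eigenbasis_def nth)
    obtain v where v: "eigenbasis d B (\<lambda>i. g ! (d - 1 - i)) v" "eigenbasis d S (\<lambda>i. \<alpha> ! i) v"
      using eigenbasis_transport[OF S V W Gw[unfolded G_def] Cw[unfolded C_def] grev]
      unfolding B_def by metis
    show ?thesis
      by (rule spectral_representation[OF S V v(2) v(1)[unfolded B_def]]) (use gpos in auto)
  qed
  have case_high: "\<exists>v. orthonormal_basis d v \<and>
        S = finsum_mat d (\<lambda>i. complex_of_real (\<alpha> ! i) \<cdot>\<^sub>m rank_one (v i) (v i)) {..<d} \<and>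
        mat_abs (mat_adjoint V) = finsum_mat d
              (\<lambda>i. complex_of_real (sqrt (g ! i)) \<cdot>\<^sub>m rank_one (v i) (v i)) {..<d}"
    if eq: "vec_of_list \<mu> = vec_of_list hi"
  proof -
    have "\<mu> = hi" using eq by (metis list_vec)
    then have "spectrum_is (S * B) (map2 (*) \<alpha> g)" "sorted_wrt (\<ge>) (map2 (*) \<alpha> g)"
      using sSB \<mu>(2) by (simp_all add: hi_def)
    then obtain v where v: "eigenbasis d S (\<lambda>i. \<alpha> ! i) v" "eigenbasis d B (\<lambda>i. g ! i) v"
      using product_spectrum_rigidity[OF S SH \<alpha>(1) carr(2) BH sB _ \<alpha>(2) pos(1,2)] by metis
    show ?thesis
      by (rule spectral_representation[OF S V v(1) v(2)[unfolded B_def]]) (use gpos in auto)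
  qed
  show ?thesis
    unfolding clo chi
    unfolding eC[unfolded C_def] eS e\<gamma> vec_of_list_index
    using low high mem case_low case_high by blast
qed

end
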